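(* Let $(X_i,\mathcal B_i,m_i,T_i)$ $(i=1,2)$ be probability preserving transformations which are relatively isomorphic over the factors $\mathcal C_i\subset\mathcal B_i$ $(i=1,2)$. Then for every sequence $\mathcal K=\{n_k:k\ge1\}$ of positive integers with $n_k\to\infty$, every sequence $d_k>0$ and every random variable $Y$ on $[0,\infty]$: (i) $\displaystyle\frac1{d_k}\log K^{(T_1)}_{\mathcal C_1}(n_k)\approx Y\ \Longleftrightarrow\ \frac1{d_k}\log K^{(T_2)}_{\mathcal C_2}(n_k)\approx Y$; (ii) $\overline{\mathrm{E\mbox{-}dim}}_{\mathcal K}(T_1,\mathcal C_1)=\overline{\mathrm{E\mbox{-}dim}}_{\mathcal K}(T_2,\mathcal C_2)$ and $\underline{\mathrm{E\mbox{-}dim}}_{\mathcal K}(T_1,\mathcal C_1)=\underline{\mathrm{E\mbox{-}dim}}_{\mathcal K}(T_2,\mathcal C_2)$.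
   Context: A probability preserving transformation $(X,\mathcal B,m,T)$ is an invertible measure preserving transformation $T$ of a probability space; a factor is a $T$-invariant sub-$\sigma$-algebra $\mathcal C\subset\mathcal B$; $m(\cdot\|\mathcal C)$ is conditional measure. $T_1,T_2$ are relatively isomorphic over the factors $\mathcal C_1,\mathcal C_2$ if there is an isomorphism $\pi:(X_1,\mathcal B_1,m_1,T_1)\to(X_2,\mathcal B_2,m_2,T_2)$ with $\pi\mathcal C_1=\mathcal C_2$. A countable $T$-generator is a countable measurable partition $P$ with $\sigma\big(\bigcup_{n\in\mathbb Z}T^nP\big)=\mathcal B$ mod $m$. For a countable measurable partition $P$, $P(z)$ is the element of $P$ containing $z$, $d_n^{(P)}(x,y):=\frac1n\#\{0\le k\le n-1: P(T^kx)\ne P(T^ky)\}$, $B(n,P,x,\varepsilon):=\{y\in X: d_n^{(P)}(x,y)\le\varepsilon\}$, and $$K^{(T)}_{\mathcal C}(P,n,\varepsilon)(x):=\min\Big\{\#F:\ F\subset X,\ m\Big(\bigcup_{z\in F}B(n,P,z,\varepsilon)\,\Big\|\,\mathcal C\Big)(x)>1-\varepsilon\Big\}.$$ Double limits, for random variables $Z_{k,\varepsilon}\ge0$ on $(X,\mathcal B,m)$: "$Z_{k,\varepsilon}\to Y$ in distribution as $k\to\infty,\ \varepsilon\to0$" means that for every continuous $g:[0,\infty]\to\mathbb R$, $\lim_{\varepsilon\to0}\limsup_{k\to\infty}|E(g(Z_{k,\varepsilon}))-E(g(Y))|=0$; "$Z_{k,\varepsilon}\to0$ in measure" means that for every $\eta>0$,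 $\lim_{\varepsilon\to0}\limsup_{k\to\infty}m(Z_{k,\varepsilon}>\eta)=0$; "$Z_{k,\varepsilon}\to\infty$ in measure" means that for every $M>0$, $\lim_{\varepsilon\to0}\limsup_{k\to\infty}m(Z_{k,\varepsilon}<M)=0$. The notation $\frac1{d_k}\log K^{(T)}_{\mathcal C}(n_k)\approx Y$ means that $\frac1{d_k}\log K^{(T)}_{\mathcal C}(Q,n_k,\varepsilon)\to Y$ in distribution as $k\to\infty,\varepsilon\to0$ for every countable $T$-generator $Q$. Relative entropy dimensions along $\mathcal K=\{n_k\}$: $$\overline{\mathrm{E\mbox{-}dim}}_{\mathcal K}(T,\mathcal C):=\inf\Big\{s\ge0:\ \frac{\log K^{(T)}_{\mathcal C}(P,n_k,\varepsilon)}{n_k^s}\to0\text{ in measure as }k\to\infty,\varepsilon\to0,\ \text{for every countable measurable partition }P\Big\},$$ $$\underline{\mathrm{E\mbox{-}dim}}_{\mathcal K}(T,\mathcal C):=\sup\Big\{s\ge0:\ \text{there is a countable measurable partition }P\text{ with }\frac{\log K^{(T)}_{\mathcal C}(P,n_k,\varepsilon)}{n_k^s}\to\infty\text{ in measure as }k\to\infty,\varepsilon\to0\Big\}.$$ *)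

theory Defs
  imports "HOL-Probability.Probability"
begin

section \<open>Probability preserving transformations, factors, generators\<close>

definition ppt :: "'a measure \<Rightarrow> ('a \<Rightarrow> 'a) \<Rightarrow> bool" where
  "ppt M T \<longleftrightarrow> prob_space M \<and> bij_betw T (space M) (space M) \<and>
     T \<in> measurable M M \<and> the_inv_into (space M) T \<in> measurable M M \<and> distr M M T = M"

definition eq_mod_null :: "'a measure \<Rightarrow> 'a set set \<Rightarrow> 'a set set \<Rightarrow> bool" where
  "eq_mod_null M \<A> \<B> \<longleftrightarrow>
     (\<forall>A\<in>\<A>. \<exists>B\<in>\<B>. sym_diff A B \<in> null_sets M) \<and>
     (\<forall>B\<in>\<B>. \<exists>A\<in>\<A>. sym_diff A B \<in> null_sets M)"

text \<open>As in the library theory of conditional expectations, a sub-sigma-algebra is carried by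
  a measure \<open>C\<close> of which only \<open>space C\<close> and \<open>sets C\<close> matter. Equalities between
  sigma-algebras (here and below) are understood modulo null sets.\<close>

definition is_factor :: "'a measure \<Rightarrow> ('a \<Rightarrow> 'a) \<Rightarrow> 'a measure \<Rightarrow> bool" where
  "is_factor M T C \<longleftrightarrow> subalgebra M C \<and>
     eq_mod_null M ((\<lambda>A. T -` A \<inter> space M) ` sets C) (sets C)"

definition countable_partition :: "'a measure \<Rightarrow> 'a set set \<Rightarrow> bool" where
  "countable_partition M P \<longleftrightarrow> countable P \<and> P \<subseteq> sets M \<and> partition_on (space M) P"

text \<open>The two families of sets are the \<open>T\<^sup>n P\<close> with \<open>n \<ge> 0\<close> and with \<open>n \<le> 0\<close>.\<close>

definition generator :: "'a measure \<Rightarrow> ('a \<Rightarrow> 'a) \<Rightarrow> 'a set set \<Rightarrow> bool" where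
  "generator M T P \<longleftrightarrow> countable_partition M P \<and>
     eq_mod_null M
       (sigma_sets (space M)
         ((\<Union>n. (\<lambda>A. (T ^^ n) ` A) ` P) \<union> (\<Union>n. (\<lambda>A. (T ^^ n) -` A \<inter> space M) ` P)))
       (sets M)"

section \<open>Relative isomorphism\<close>

text \<open>Isomorphisms are defined off null sets: \<open>\<pi>\<close> is an invertible, bimeasurable, measure
  preserving and equivariant map between invariant sets \<open>X1\<close>, \<open>X2\<close> of full measure.\<close>

definition ppt_isomorphism ::
  "'a measure \<Rightarrow> ('a \<Rightarrow> 'a) \<Rightarrow> 'a set \<Rightarrow> 'b measure \<Rightarrow> ('b \<Rightarrow> 'b) \<Rightarrow> 'b set \<Rightarrow> ('a \<Rightarrow> 'b) \<Rightarrow> bool"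
  where
  "ppt_isomorphism M1 T1 X1 M2 T2 X2 \<pi> \<longleftrightarrow>
     X1 \<in> sets M1 \<and> space M1 - X1 \<in> null_sets M1 \<and> T1 ` X1 = X1 \<and>
     X2 \<in> sets M2 \<and> space M2 - X2 \<in> null_sets M2 \<and> T2 ` X2 = X2 \<and>
     bij_betw \<pi> X1 X2 \<and>
     \<pi> \<in> measurable (restrict_space M1 X1) (restrict_space M2 X2) \<and>
     the_inv_into X1 \<pi> \<in> measurable (restrict_space M2 X2) (restrict_space M1 X1) \<and>
     distr (restrict_space M1 X1) (restrict_space M2 X2) \<pi> = restrict_space M2 X2 \<and>
     (\<forall>x\<in>X1. \<pi> (T1 x) = T2 (\<pi> x))"

definition relatively_isomorphic ::
  "'a measure \<Rightarrow> ('a \<Rightarrow> 'a) \<Rightarrow> 'a measure \<Rightarrow> 'b measure \<Rightarrow> ('b \<Rightarrow> 'b) \<Rightarrow> 'b measure \<Rightarrow> bool" where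
  "relatively_isomorphic M1 T1 C1 M2 T2 C2 \<longleftrightarrow>
     (\<exists>X1 X2 \<pi>. ppt_isomorphism M1 T1 X1 M2 T2 X2 \<pi> \<and>
        eq_mod_null M2 ((\<lambda>A. \<pi> ` (A \<inter> X1)) ` sets C1) (sets C2))"

section \<open>Relative complexity\<close>

definition cell :: "'a set set \<Rightarrow> 'a \<Rightarrow> 'a set" where
  "cell P z = (THE A. A \<in> P \<and> z \<in> A)"

definition hamming_dist :: "('a \<Rightarrow> 'a) \<Rightarrow> 'a set set \<Rightarrow> nat \<Rightarrow> 'a \<Rightarrow> 'a \<Rightarrow> real" where
  "hamming_dist T P n x y =
     real (card {k. k < n \<and> cell P ((T ^^ k) x) \<noteq> cell P ((T ^^ k) y)}) / real n"

definition hamming_ball ::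
  "'a measure \<Rightarrow> ('a \<Rightarrow> 'a) \<Rightarrow> nat \<Rightarrow> 'a set set \<Rightarrow> 'a \<Rightarrow> real \<Rightarrow> 'a set" where
  "hamming_ball M T n P x \<epsilon> = {y \<in> space M. hamming_dist T P n x y \<le> \<epsilon>}"

text \<open>For fixed \<open>n\<close> and \<open>\<epsilon>\<close> there are only countably many distinct finite unions of Hamming
  balls, so up to a null set the choice of versions of the conditional probabilities is
  irrelevant. For \<open>\<epsilon> > 0\<close> the infimum is a minimum over a nonempty set for almost every \<open>x\<close>;
  it is 0 on the exceptional null set.\<close>

definition rel_complexity ::
  "'a measure \<Rightarrow> ('a \<Rightarrow> 'a) \<Rightarrow> 'a measure \<Rightarrow> 'a set set \<Rightarrow> nat \<Rightarrow> real \<Rightarrow> 'a \<Rightarrow> nat" where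
  "rel_complexity M T C P n \<epsilon> x =
     Inf (card ` {F. finite F \<and> F \<subseteq> space M \<and>
       real_cond_exp M C (indicator (\<Union>z\<in>F. hamming_ball M T n P z \<epsilon>)) x > 1 - \<epsilon>})"

section \<open>Double limits\<close>

definition dlim_in_distribution ::
  "'a measure \<Rightarrow> (nat \<Rightarrow> real \<Rightarrow> 'a \<Rightarrow> ennreal) \<Rightarrow> 'c measure \<Rightarrow> ('c \<Rightarrow> ennreal) \<Rightarrow> bool" where
  "dlim_in_distribution M Z N Y \<longleftrightarrow>
     (\<forall>g :: ennreal \<Rightarrow> real. continuous_on UNIV g \<longrightarrow>
        ((\<lambda>\<epsilon>. limsup (\<lambda>k. ereal \<bar>(\<integral>x. g (Z k \<epsilon> x) \<partial>M) - (\<integral>y. g (Y y) \<partial>N)\<bar>)) \<longlongrightarrow> 0)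
          (at_right 0))"

definition dlim_zero_in_measure ::
  "'a measure \<Rightarrow> (nat \<Rightarrow> real \<Rightarrow> 'a \<Rightarrow> ennreal) \<Rightarrow> bool" where
  "dlim_zero_in_measure M Z \<longleftrightarrow>
     (\<forall>\<eta>::real. \<eta> > 0 \<longrightarrow>
        ((\<lambda>\<epsilon>. limsup (\<lambda>k. ereal (measure M {x \<in> space M. Z k \<epsilon> x > ennreal \<eta>}))) \<longlongrightarrow> 0)
          (at_right 0))"

definition dlim_infinity_in_measure ::
  "'a measure \<Rightarrow> (nat \<Rightarrow> real \<Rightarrow> 'a \<Rightarrow> ennreal) \<Rightarrow> bool" where
  "dlim_infinity_in_measure M Z \<longleftrightarrow>
     (\<forall>b::real. b > 0 \<longrightarrow>
        ((\<lambda>\<epsilon>. limsup (\<lambda>k. ereal (measure M {x \<in> space M. Z k \<epsilon> x < ennreal b}))) \<longlongrightarrow> 0)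
          (at_right 0))"

section \<open>Asymptotic relative complexity and entropy dimensions\<close>

text \<open>This is the relation \<open>(1/d\<^sub>k) log K\<^sub>C(n\<^sub>k) \<approx> Y\<close>, with \<open>Y\<close> a random variable on \<open>N\<close>.\<close>

definition complexity_approx ::
  "'a measure \<Rightarrow> ('a \<Rightarrow> 'a) \<Rightarrow> 'a measure \<Rightarrow> (nat \<Rightarrow> nat) \<Rightarrow> (nat \<Rightarrow> real) \<Rightarrow>
    'c measure \<Rightarrow> ('c \<Rightarrow> ennreal) \<Rightarrow> bool" where
  "complexity_approx M T C n d N Y \<longleftrightarrow>
     (\<forall>Q. generator M T Q \<longrightarrow>
        dlim_in_distribution M
          (\<lambda>k \<epsilon> x. ennreal (1 / d k * ln (real (rel_complexity M T C Q (n k) \<epsilon> x)))) N Y)"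

definition log_complexity_ratio ::
  "'a measure \<Rightarrow> ('a \<Rightarrow> 'a) \<Rightarrow> 'a measure \<Rightarrow> 'a set set \<Rightarrow> (nat \<Rightarrow> nat) \<Rightarrow> real \<Rightarrow>
    nat \<Rightarrow> real \<Rightarrow> 'a \<Rightarrow> ennreal" where
  "log_complexity_ratio M T C P n s k \<epsilon> x =
     ennreal (ln (real (rel_complexity M T C P (n k) \<epsilon> x)) / real (n k) powr s)"

text \<open>The dimensions take values in \<open>[0, \<infinity>]\<close>, with the conventions \<open>inf {} = \<infinity>\<close>
  and \<open>sup {} = 0\<close>.\<close>

definition upper_E_dim ::
  "(nat \<Rightarrow> nat) \<Rightarrow> 'a measure \<Rightarrow> ('a \<Rightarrow> 'a) \<Rightarrow> 'a measure \<Rightarrow> ennreal" where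
  "upper_E_dim n M T C =
     Inf (ennreal ` {s. s \<ge> 0 \<and>
       (\<forall>P. countable_partition M P \<longrightarrow>
          dlim_zero_in_measure M (log_complexity_ratio M T C P n s))})"

definition lower_E_dim ::
  "(nat \<Rightarrow> nat) \<Rightarrow> 'a measure \<Rightarrow> ('a \<Rightarrow> 'a) \<Rightarrow> 'a measure \<Rightarrow> ennreal" where
  "lower_E_dim n M T C =
     Sup (ennreal ` {s. s \<ge> 0 \<and>
       (\<exists>P. countable_partition M P \<and>
          dlim_infinity_in_measure M (log_complexity_ratio M T C P n s))})"

end

theory Submission imports Defs begin

text \<open>
  Relative complexity is almost an isomorphism invariant, and the double limits in \<open>k\<close> and \<open>\<epsilon>\<close>
  absorb the difference.

  A relative isomorphism induces a measure preserving map \<open>p\<close> from \<open>M1\<close> to \<open>M2\<close>, equivariant on an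
  invariant set \<open>X\<close> of full measure. A countable partition \<open>Q\<close> of \<open>M2\<close> is pulled back to the
  partition of \<open>M1\<close> into the sets \<open>p -` A \<inter> X\<close> for \<open>A \<in> Q\<close> and the complement of \<open>X\<close>. On \<open>X\<close> the
  Hamming distances for the two partitions correspond under \<open>p\<close>, and so do the conditional
  probabilities given the two factors, as these correspond up to null sets
  (\<open>real_cond_exp_pullback\<close>). The complexities nevertheless need not be equal: the centres of the
  balls range over all points, and a centre in an exceptional null set may have a ball of positive
  measure that no other point has. On the pulled back side such centres are useless, since they are
  at distance 1 from \<open>X\<close>; on the other side a ball is contained in the ball of twice the radius around
  any of its points. Hence almost everywhere
  \<open>K\<^sub>P(n, 2\<epsilon>)(x) \<le> K\<^sub>Q(n, \<epsilon>)(p x) \<le> K\<^sub>P(n, \<epsilon>)(x)\<close>, where \<open>P\<close> is the pullback of \<open>Q\<close>,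
  for \<open>0 < \<epsilon> < 1\<close> (\<open>rel_complexity_pullback_le\<close>, \<open>rel_complexity_le_pullback\<close>). Both inequalities
  rely on the fact that the minimum defining the complexity is attained almost everywhere
  (\<open>AE_covers_exists\<close>).

  If the outer terms, suitably normalised, converge in distribution as \<open>k \<rightarrow> \<infinity>\<close>, \<open>\<epsilon> \<rightarrow> 0\<close>, then the
  middle one has the same limit (\<open>dlim_in_distribution_sandwich\<close>). Convergence to 0 passes from \<open>M1\<close>
  to \<open>M2\<close> by the right inequality, and convergence to infinity from \<open>M2\<close> to \<open>M1\<close>. Generators pull back to
  generators (\<open>generator_pullback\<close>). This proves one implication in the first claim and one inequality
  for each of the two dimensions; the inverse isomorphism gives the others.
\<close>

section \<open>Double limits squeezed between two scales\<close>

text \<open>The iterated limit in the three modes of double convergence, as a statement about thresholds.\<close>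

lemma limsup_tendsto_0_at_right_iff:
  fixes a :: "nat \<Rightarrow> real \<Rightarrow> real"
  assumes nonneg: "\<And>k \<epsilon>. 0 \<le> a k \<epsilon>"
  shows "((\<lambda>\<epsilon>. limsup (\<lambda>k. ereal (a k \<epsilon>))) \<longlongrightarrow> 0) (at_right 0) \<longleftrightarrow>
    (\<forall>e>0. \<forall>\<^sub>F \<epsilon> in at_right 0. \<forall>\<^sub>F k in sequentially. a k \<epsilon> < e)"
proof
  assume L: "((\<lambda>\<epsilon>. limsup (\<lambda>k. ereal (a k \<epsilon>))) \<longlongrightarrow> 0) (at_right 0)"
  show "\<forall>e>0. \<forall>\<^sub>F \<epsilon> in at_right 0. \<forall>\<^sub>F k in sequentially. a k \<epsilon> < e"
  proof (intro allI impI)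
    fix e :: real assume "e > 0"
    then have "\<forall>\<^sub>F \<epsilon> in at_right 0. limsup (\<lambda>k. ereal (a k \<epsilon>)) < ereal e"
      using order_tendstoD(2)[OF L, of "ereal e"] by simp
    then show "\<forall>\<^sub>F \<epsilon> in at_right 0. \<forall>\<^sub>F k in sequentially. a k \<epsilon> < e"
    proof (rule eventually_mono)
      fix \<epsilon> assume "limsup (\<lambda>k. ereal (a k \<epsilon>)) < ereal e"
      from Limsup_lessD[OF this] show "\<forall>\<^sub>F k in sequentially. a k \<epsilon> < e" by simp
    qed
  qed
next
  assume R: "\<forall>e>0. \<forall>\<^sub>F \<epsilon> in at_right 0. \<forall>\<^sub>F k in sequentially. a k \<epsilon> < e"
  show "((\<lambda>\<epsilon>. limsup (\<lambda>k. ereal (a k \<epsilon>))) \<longlongrightarrow> 0) (at_right 0)"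
  proof (rule order_tendstoI)
    fix c :: ereal assume "c < 0"
    moreover have "0 \<le> limsup (\<lambda>k. ereal (a k \<epsilon>))" for \<epsilon>
      by (rule le_Limsup) (auto simp: nonneg)
    ultimately show "\<forall>\<^sub>F \<epsilon> in at_right 0. c < limsup (\<lambda>k. ereal (a k \<epsilon>))"
      by (intro always_eventually allI) (rule less_le_trans)
  next
    fix c :: ereal assume "0 < c"
    then obtain e where e: "0 < ereal e" "ereal e < c" using ereal_dense2 by blast
    then have "\<forall>\<^sub>F \<epsilon> in at_right 0. \<forall>\<^sub>F k in sequentially. a k \<epsilon> < e" using R by simp
    then show "\<forall>\<^sub>F \<epsilon> in at_right 0. limsup (\<lambda>k. ereal (a k \<epsilon>)) < c"
    proof (rule eventually_mono)
      fix \<epsilon> assume "\<forall>\<^sub>F k in sequentially. a k \<epsilon> < e"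
      then have "limsup (\<lambda>k. ereal (a k \<epsilon>)) \<le> ereal e"
        by (intro Limsup_bounded) (auto elim: eventually_mono)
      then show "limsup (\<lambda>k. ereal (a k \<epsilon>)) < c" using e by simp
    qed
  qed
qed

lemma eventually_at_right_0_double:
  assumes "eventually P (at_right (0::real))"
  shows "eventually (\<lambda>\<epsilon>. P (2 * \<epsilon>)) (at_right 0)"
proof -
  obtain b where b: "b > 0" "\<And>y. 0 < y \<Longrightarrow> y < b \<Longrightarrow> P y"
    using assms unfolding eventually_at_right_field by auto
  show ?thesis unfolding eventually_at_right_field
    using b by (intro exI[of _ "b / 2"]) auto
qed

text \<open>The order-reversing homeomorphism from \<open>[0, \<infinity>]\<close> onto \<open>[0, 1]\<close>. It serves as a single
  monotone test function by which all continuous test functions are controlled.\<close>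

definition inv_succ :: "ennreal \<Rightarrow> real" where
  "inv_succ x = enn2real (inverse (1 + x))"

lemma inv_succ_ennreal: "0 \<le> r \<Longrightarrow> inv_succ (ennreal r) = 1 / (1 + r)"
proof -
  assume "0 \<le> r"
  then have "1 + ennreal r = ennreal (1 + r)" by simp
  then have "inverse (1 + ennreal r) = ennreal (1 / (1 + r))"
    using \<open>0 \<le> r\<close> by (simp add: inverse_ennreal inverse_eq_divide del: ennreal_plus)
  then show ?thesis using \<open>0 \<le> r\<close> by (simp add: inv_succ_def)
qed

lemma inv_succ_top: "inv_succ top = 0"
  by (simp add: inv_succ_def)

lemma inv_succ_bounds: "0 \<le> inv_succ x" "inv_succ x \<le> 1"
  by (cases x; simp add: inv_succ_ennreal inv_succ_top)+

lemma antimono_inv_succ: "x \<le> y \<Longrightarrow> inv_succ y \<le> inv_succ x"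
  by (cases x; cases y; simp add: inv_succ_ennreal inv_succ_top frac_le top_unique)

lemma continuous_on_inv_succ: "continuous_on UNIV inv_succ"
proof (rule continuous_at_imp_continuous_on, rule ballI)
  fix x :: ennreal
  have "continuous_on UNIV (\<lambda>x::ennreal. inverse (1 + x))"
    by (intro continuous_intros continuous_on_add_ennreal)
  then have "((\<lambda>y. inverse (1 + y)) \<longlongrightarrow> inverse (1 + x)) (at x)"
    by (simp add: continuous_on_eq_continuous_at isCont_def)
  moreover have "inverse (1 + x) \<noteq> top" by simp
  then have "inverse (1 + x) = ennreal (inv_succ x)"
    unfolding inv_succ_def less_top by simp
  ultimately have "((\<lambda>y. enn2real (inverse (1 + y))) \<longlongrightarrow> inv_succ x) (at x)"
    by (intro tendsto_enn2real inv_succ_bounds) simp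
  then show "isCont inv_succ x"
    unfolding isCont_def inv_succ_def .
qed

text \<open>Uniform continuity of \<open>g\<close> in the coordinate \<open>inv_succ\<close> makes \<open>\<bar>g a - g b\<bar>\<close> small when the
  coordinates are \<open>\<delta>\<close>-close; otherwise \<open>\<bar>g a - g b\<bar>\<close> is at most twice the bound \<open>B\<close> of \<open>\<bar>g\<bar>\<close>, which is
  \<open>2 * B / \<delta>\<close> times the distance \<open>\<delta>\<close> of the coordinates.\<close>

lemma continuous_ennreal_lipschitz_mod_inv_succ:
  fixes g :: "ennreal \<Rightarrow> real"
  assumes g: "continuous_on UNIV g" and "e > 0"
  obtains C where "C \<ge> 0" "\<And>a b. \<bar>g a - g b\<bar> \<le> e + C * \<bar>inv_succ a - inv_succ b\<bar>"
proof -
  define \<phi> :: "real \<Rightarrow> ennreal" where "\<phi> t = inverse (ennreal t) - 1" for t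
  have \<phi>: "\<phi> (inv_succ x) = x" for x
  proof (cases x)
    case (real r)
    then have "\<phi> (inv_succ x) = ennreal (1 + r) - ennreal 1"
      by (simp add: \<phi>_def inv_succ_ennreal inverse_ennreal)
    also have "\<dots> = ennreal r" by (subst ennreal_minus) auto
    finally show ?thesis using real by simp
  qed (simp add: \<phi>_def inv_succ_top)
  have "continuous_on {0..1} \<phi>"
    unfolding \<phi>_def
    unfolding continuous_on_def
    by (auto intro!: tendsto_diff_ennreal_general
      continuous_on_inverse_ennreal[OF continuous_on_ennreal[OF continuous_on_id], unfolded continuous_on_def, rule_format])
  then have cont: "continuous_on {0..1} (\<lambda>t. g (\<phi> t))"
    by (rule continuous_on_compose2[OF g]) auto
  then have "uniformly_continuous_on {0..1} (\<lambda>t. g (\<phi> t))"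
    by (intro compact_uniformly_continuous) auto
  then obtain \<delta> where \<delta>: "\<delta> > 0"
    "\<And>s t. s \<in> {0..1} \<Longrightarrow> t \<in> {0..1} \<Longrightarrow> \<bar>t - s\<bar> < \<delta> \<Longrightarrow> \<bar>g (\<phi> t) - g (\<phi> s)\<bar> < e"
    using \<open>e > 0\<close> unfolding uniformly_continuous_on_def dist_real_def by meson
  have "bounded ((\<lambda>t. g (\<phi> t)) ` {0..1})"
    by (intro compact_imp_bounded compact_continuous_image cont) auto
  then obtain B where B: "\<And>t. t \<in> {0..1} \<Longrightarrow> \<bar>g (\<phi> t)\<bar> \<le> B"
    unfolding bounded_iff by (metis image_eqI real_norm_def)
  have "B \<ge> 0" using B[of 0] by simp
  show thesis
  proof
    show "2 * B / \<delta> \<ge> 0" using \<open>B \<ge> 0\<close> \<delta>(1) by simp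
    fix a b
    let ?s = "inv_succ a" and ?t = "inv_succ b"
    have in01: "?s \<in> {0..1}" "?t \<in> {0..1}" by (auto simp: inv_succ_bounds)
    show "\<bar>g a - g b\<bar> \<le> e + 2 * B / \<delta> * \<bar>?s - ?t\<bar>"
    proof (cases "\<bar>?s - ?t\<bar> < \<delta>")
      case True
      then have "\<bar>g a - g b\<bar> < e" using \<delta>(2)[OF in01(2,1)] by (simp add: \<phi>)
      moreover have "0 \<le> 2 * B / \<delta> * \<bar>?s - ?t\<bar>" using \<open>B \<ge> 0\<close> \<delta>(1) by simp
      ultimately show ?thesis by linarith
    next
      case False
      then have "2 * B * 1 \<le> 2 * B * (\<bar>?s - ?t\<bar> / \<delta>)"
        using \<open>B \<ge> 0\<close> \<delta>(1) by (intro mult_left_mono) (auto simp: field_simps)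
      moreover have "\<bar>g a - g b\<bar> \<le> 2 * B"
        using B[OF in01(1)] B[OF in01(2)] by (simp add: \<phi>)
      ultimately show ?thesis using \<open>e > 0\<close> by simp
    qed
  qed
qed

lemma integrable_continuous_ennreal:
  fixes g :: "ennreal \<Rightarrow> real"
  assumes "prob_space M" and [measurable]: "Z \<in> borel_measurable M" and g: "continuous_on UNIV g"
  shows "integrable M (\<lambda>x. g (Z x))"
proof -
  interpret prob_space M by fact
  obtain C where C: "C \<ge> 0" "\<And>a b. \<bar>g a - g b\<bar> \<le> 1 + C * \<bar>inv_succ a - inv_succ b\<bar>"
    using continuous_ennreal_lipschitz_mod_inv_succ[OF g zero_less_one] by blast
  have [measurable]: "g \<in> borel_measurable borel"
    by (rule borel_measurable_continuous_onI[OF g])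
  have "\<bar>g a\<bar> \<le> \<bar>g 0\<bar> + (1 + C)" for a
  proof -
    have "\<bar>inv_succ a - inv_succ 0\<bar> \<le> 1"
      using inv_succ_bounds[of a] inv_succ_bounds[of 0] by linarith
    then have "C * \<bar>inv_succ a - inv_succ 0\<bar> \<le> C * 1" using C(1) by (rule mult_left_mono)
    then show ?thesis using C(2)[of a 0] by linarith
  qed
  then show ?thesis
    by (intro integrable_const_bound[where B = "\<bar>g 0\<bar> + (1 + C)"]) auto
qed

text \<open>Both \<open>Z k \<epsilon>\<close> and \<open>Z k (2 * \<epsilon>)\<close> have the distributional limit \<open>Y\<close>. They are ordered pointwise, so
  the \<open>L\<^sup>1\<close> distance of their images under the monotone function \<open>inv_succ\<close> is the difference of two
  expectations with the same limit, hence tends to 0. Anything in between, such as \<open>W k \<epsilon>\<close>, is then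
  equally close, and by the preceding Lipschitz estimate so are the integrals of any continuous
  function.\<close>

lemma dlim_in_distribution_sandwich:
  assumes M: "prob_space M"
    and Z[measurable]: "\<And>k \<epsilon>. Z k \<epsilon> \<in> borel_measurable M"
    and W[measurable]: "\<And>k \<epsilon>. W k \<epsilon> \<in> borel_measurable M"
    and squeeze: "\<And>k \<epsilon>. 0 < \<epsilon> \<Longrightarrow> \<epsilon> < 1/2 \<Longrightarrow>
      AE x in M. Z k (2 * \<epsilon>) x \<le> W k \<epsilon> x \<and> W k \<epsilon> x \<le> Z k \<epsilon> x"
    and lim: "dlim_in_distribution M Z N Y"
  shows "dlim_in_distribution M W N Y"
proof -
  interpret prob_space M by fact
  define D where "D V g k \<epsilon> = \<bar>(\<integral>x. g (V k \<epsilon> x) \<partial>M) - (\<integral>y. g (Y y) \<partial>N)\<bar>"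
    for V :: "nat \<Rightarrow> real \<Rightarrow> 'a \<Rightarrow> ennreal" and g :: "ennreal \<Rightarrow> real" and k \<epsilon>
  have small: "\<forall>\<^sub>F \<epsilon> in at_right 0. \<forall>\<^sub>F k in sequentially. D Z g k \<epsilon> < e"
    if "continuous_on UNIV g" "e > 0" for g e
  proof -
    have "((\<lambda>\<epsilon>. limsup (\<lambda>k. ereal (D Z g k \<epsilon>))) \<longlongrightarrow> 0) (at_right 0)"
      using lim that(1) unfolding dlim_in_distribution_def D_def by blast
    moreover have "0 \<le> D Z g k \<epsilon>" for k \<epsilon> by (simp add: D_def)
    ultimately show ?thesis using that(2) limsup_tendsto_0_at_right_iff[of "D Z g"] by blast
  qed
  have "\<forall>\<^sub>F \<epsilon> in at_right 0. \<forall>\<^sub>F k in sequentially. D W g k \<epsilon> < e"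
    if g: "continuous_on UNIV g" and "e > 0" for g e
  proof -
    obtain C where C: "C \<ge> 0" "\<And>a b. \<bar>g a - g b\<bar> \<le> e / 4 + C * \<bar>inv_succ a - inv_succ b\<bar>"
      using continuous_ennreal_lipschitz_mod_inv_succ[OF g, of "e / 4"] \<open>e > 0\<close> by auto
    define e' where "e' = e / (4 * (C + 1))"
    have e': "e' > 0" "C * e' \<le> e / 4" using C(1) \<open>e > 0\<close> by (auto simp: e'_def field_simps)
    have bound: "D W g k \<epsilon> \<le> e / 4 + D Z g k \<epsilon> + C * (D Z inv_succ k (2 * \<epsilon>) + D Z inv_succ k \<epsilon>)"
      if \<epsilon>: "0 < \<epsilon>" "\<epsilon> < 1/2" for k \<epsilon>
    proof -
      have int: "integrable M (\<lambda>x. g (W k \<epsilon> x))" "integrable M (\<lambda>x. g (Z k \<epsilon> x))"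
        "integrable M (\<lambda>x. inv_succ (Z k (2 * \<epsilon>) x))" "integrable M (\<lambda>x. inv_succ (Z k \<epsilon> x))"
        by (intro integrable_continuous_ennreal[OF M] g continuous_on_inv_succ Z W)+
      have "\<bar>(\<integral>x. g (W k \<epsilon> x) \<partial>M) - (\<integral>x. g (Z k \<epsilon> x) \<partial>M)\<bar>
          = \<bar>\<integral>x. g (W k \<epsilon> x) - g (Z k \<epsilon> x) \<partial>M\<bar>"
        using int by simp
      also have "\<dots> \<le> (\<integral>x. \<bar>g (W k \<epsilon> x) - g (Z k \<epsilon> x)\<bar> \<partial>M)"
        by (rule integral_abs_bound)
      also have "\<dots> \<le> (\<integral>x. e / 4 + C * (inv_succ (Z k (2 * \<epsilon>) x) - inv_succ (Z k \<epsilon> x)) \<partial>M)"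
      proof (rule integral_mono_AE)
        show "AE x in M. \<bar>g (W k \<epsilon> x) - g (Z k \<epsilon> x)\<bar>
            \<le> e / 4 + C * (inv_succ (Z k (2 * \<epsilon>) x) - inv_succ (Z k \<epsilon> x))"
          using squeeze[OF \<epsilon>, of k]
        proof eventually_elim
          case (elim x)
          then have "\<bar>inv_succ (W k \<epsilon> x) - inv_succ (Z k \<epsilon> x)\<bar>
              \<le> inv_succ (Z k (2 * \<epsilon>) x) - inv_succ (Z k \<epsilon> x)"
            using antimono_inv_succ[of "W k \<epsilon> x" "Z k \<epsilon> x"]
              antimono_inv_succ[of "Z k (2 * \<epsilon>) x" "W k \<epsilon> x"] by simp
          from mult_left_mono[OF this C(1)] show ?case
            using C(2)[of "W k \<epsilon> x" "Z k \<epsilon> x"] by linarith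
        qed
      qed (use int in auto)
      also have "\<dots> = e / 4 +
          C * ((\<integral>x. inv_succ (Z k (2 * \<epsilon>) x) \<partial>M) - (\<integral>x. inv_succ (Z k \<epsilon> x) \<partial>M))"
        using int by (simp add: prob_space)
      also have "\<dots> \<le> e / 4 + C * (D Z inv_succ k (2 * \<epsilon>) + D Z inv_succ k \<epsilon>)"
        unfolding D_def by (intro add_left_mono mult_left_mono C(1)) linarith
      finally show ?thesis unfolding D_def by linarith
    qed
    have lt: "\<forall>\<^sub>F \<epsilon> in at_right 0. \<epsilon> < 1/2 \<and> (0::real) < \<epsilon>"
      unfolding eventually_at_right_field by (intro exI[of _ "1/2"]) auto
    have "e / 4 > 0" using \<open>e > 0\<close> by simp
    note lims = lt small[OF g this] small[OF continuous_on_inv_succ e'(1)]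
      eventually_at_right_0_double[OF small[OF continuous_on_inv_succ e'(1)]]
    from lims show ?thesis
    proof eventually_elim
      fix \<epsilon> :: real
      assume \<epsilon>: "\<epsilon> < 1/2 \<and> 0 < \<epsilon>"
        and "\<forall>\<^sub>F k in sequentially. D Z g k \<epsilon> < e / 4"
        and "\<forall>\<^sub>F k in sequentially. D Z inv_succ k \<epsilon> < e'"
        and "\<forall>\<^sub>F k in sequentially. D Z inv_succ k (2 * \<epsilon>) < e'"
      from this(2,3,4) show "\<forall>\<^sub>F k in sequentially. D W g k \<epsilon> < e"
      proof eventually_elim
        fix k
        assume k: "D Z g k \<epsilon> < e / 4" "D Z inv_succ k \<epsilon> < e'" "D Z inv_succ k (2 * \<epsilon>) < e'"
        then have "C * (D Z inv_succ k (2 * \<epsilon>) + D Z inv_succ k \<epsilon>) \<le> C * (e' + e')"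
          using C(1) by (intro mult_left_mono) auto
        then have "C * (D Z inv_succ k (2 * \<epsilon>) + D Z inv_succ k \<epsilon>) \<le> e / 2"
          using e'(2) by (simp add: algebra_simps)
        moreover have "D W g k \<epsilon> \<le> e / 4 + D Z g k \<epsilon> + C * (D Z inv_succ k (2 * \<epsilon>) + D Z inv_succ k \<epsilon>)"
          using bound \<epsilon> by blast
        ultimately show "D W g k \<epsilon> < e" using k(1) by linarith
      qed
    qed
  qed
  then show ?thesis
    unfolding dlim_in_distribution_def D_def
    by (subst limsup_tendsto_0_at_right_iff) auto
qed

section \<open>Conditional expectations and null sets\<close>

text \<open>Factors of isomorphic systems correspond only up to null sets. Completing a factor by the
  measurable sets that agree with one of its members up to a null set turns such a correspondence
  into an exact one.\<close>

definition mod_null_algebra :: "'a measure \<Rightarrow> 'a measure \<Rightarrow> 'a measure" where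
  "mod_null_algebra M C = sigma (space M) {A \<in> sets M. \<exists>B\<in>sets C. sym_diff A B \<in> null_sets M}"

lemma sets_mod_null_algebra:
  assumes "subalgebra M C"
  shows "sets (mod_null_algebra M C) = {A \<in> sets M. \<exists>B\<in>sets C. sym_diff A B \<in> null_sets M}"
    (is "_ = ?S")
proof -
  have C: "space C = space M" "sets C \<subseteq> sets M" using assms by (auto simp: subalgebra_def)
  have "sigma_algebra (space M) ?S"
    unfolding sigma_algebra_iff2
  proof (intro conjI ballI allI impI)
    show "?S \<subseteq> Pow (space M)" using sets.sets_into_space by auto
    show "{} \<in> ?S" by (auto intro!: bexI[of _ "{}"])
  next
    fix A assume "A \<in> ?S"
    then obtain B where B: "A \<in> sets M" "B \<in> sets C" "sym_diff A B \<in> null_sets M" by auto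
    have "A \<subseteq> space M" "B \<subseteq> space M" using B C sets.sets_into_space by blast+
    then have "sym_diff (space M - A) (space M - B) = sym_diff A B" by auto
    moreover have "space M - B \<in> sets C" using B(2) C(1) by (metis sets.compl_sets)
    ultimately show "space M - A \<in> ?S"
      using B(1,3) by (auto intro!: bexI[of _ "space M - B"])
  next
    fix A :: "nat \<Rightarrow> 'a set" assume A: "range A \<subseteq> ?S"
    then have "\<forall>i. \<exists>B\<in>sets C. sym_diff (A i) B \<in> null_sets M" by auto
    then obtain B where B: "\<And>i. B i \<in> sets C" "\<And>i. sym_diff (A i) (B i) \<in> null_sets M"
      by metis
    have meas: "(\<Union>i. A i) \<in> sets M" "(\<Union>i. B i) \<in> sets C"
      using A B(1) by (auto intro!: sets.countable_UN)
    have "sym_diff (\<Union>i. A i) (\<Union>i. B i) \<in> null_sets M"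
    proof (rule null_sets_subset)
      show "(\<Union>i. sym_diff (A i) (B i)) \<in> null_sets M" using B(2) by (rule null_sets_UN)
      show "sym_diff (\<Union>i. A i) (\<Union>i. B i) \<in> sets M" using meas C(2) by auto
    qed auto
    with meas show "(\<Union>i. A i) \<in> ?S" by blast
  qed
  then show ?thesis
    unfolding mod_null_algebra_def by (rule sigma_algebra.sets_measure_of_eq)
qed

lemma space_mod_null_algebra: "space (mod_null_algebra M C) = space M"
  unfolding mod_null_algebra_def using sets.sets_into_space by (subst space_measure_of) auto

lemma subalgebra_mod_null_algebra:
  assumes "subalgebra M C"
  shows "subalgebra M (mod_null_algebra M C)" "subalgebra (mod_null_algebra M C) C"
proof -
  have C: "space C = space M" "sets C \<subseteq> sets M" using assms by (auto simp: subalgebra_def)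
  have "A \<in> sets (mod_null_algebra M C)" if "A \<in> sets C" for A
    unfolding sets_mod_null_algebra[OF assms] using that C(2)
    by (auto intro: bexI[of _ A])
  then show "subalgebra (mod_null_algebra M C) C"
    by (auto simp: subalgebra_def space_mod_null_algebra C(1))
  show "subalgebra M (mod_null_algebra M C)"
    by (auto simp: subalgebra_def space_mod_null_algebra sets_mod_null_algebra[OF assms])
qed

lemma AE_mem_eq_of_null_sym_diff:
  assumes "sym_diff A B \<in> null_sets M"
  shows "AE x in M. x \<in> A \<longleftrightarrow> x \<in> B"
  using AE_not_in[OF assms] by eventually_elim auto

text \<open>The conditional expectations given \<open>C\<close> and given its completion coincide, since the latter is
  characterised by integrals over sets that may be replaced by members of \<open>C\<close>; and \<open>g\<close> is measurable
  with respect to the completion.\<close>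

lemma real_cond_exp_eqI_mod_null:
  fixes f g :: "'a \<Rightarrow> real"
  assumes "finite_measure_subalgebra M C"
    and f: "integrable M f" and g: "integrable M g"
    and meas: "\<And>S. S \<in> sets borel \<Longrightarrow> \<exists>B\<in>sets C. sym_diff (g -` S \<inter> space M) B \<in> null_sets M"
    and int: "\<And>A. A \<in> sets C \<Longrightarrow> (\<integral>x\<in>A. f x \<partial>M) = (\<integral>x\<in>A. g x \<partial>M)"
  shows "AE x in M. real_cond_exp M C f x = g x"
proof -
  interpret C: finite_measure_subalgebra M C by fact
  define C' where "C' = mod_null_algebra M C"
  note sub = subalgebra_mod_null_algebra[OF C.subalg, folded C'_def]
  interpret C': finite_measure_subalgebra M C'
    by unfold_locales (rule sub)
  have charact: "AE x in M. real_cond_exp M C' f x = h x"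
    if h: "integrable M h" "h \<in> borel_measurable C'"
      "\<And>A. A \<in> sets C \<Longrightarrow> (\<integral>x\<in>A. f x \<partial>M) = (\<integral>x\<in>A. h x \<partial>M)" for h
  proof (rule C'.real_cond_exp_charact)
    fix A assume "A \<in> sets C'"
    then obtain B where B: "A \<in> sets M" "B \<in> sets C" "sym_diff A B \<in> null_sets M"
      unfolding C'_def sets_mod_null_algebra[OF C.subalg] by auto
    have "B \<in> sets M" using B(2) C.subalg by (auto simp: subalgebra_def)
    then show "(\<integral>x\<in>A. f x \<partial>M) = (\<integral>x\<in>A. h x \<partial>M)"
      using set_integral_null_delta[OF f B(1) _ B(3)] set_integral_null_delta[OF h(1) B(1) _ B(3)]
        h(3)[OF B(2)] by simp
  qed (use f h in auto)
  have "g \<in> borel_measurable C'"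
  proof (rule measurableI)
    fix S :: "real set" assume "S \<in> sets borel"
    then show "g -` S \<inter> space C' \<in> sets C'"
      using meas g unfolding C'_def sets_mod_null_algebra[OF C.subalg] space_mod_null_algebra
      by (auto intro: measurable_sets)
  qed simp
  then have "AE x in M. real_cond_exp M C' f x = g x"
    using g int by (intro charact)
  moreover have "AE x in M. real_cond_exp M C' f x = real_cond_exp M C f x"
    using C.real_cond_exp_int(1)[OF f] measurable_from_subalg[OF sub(2) borel_measurable_cond_exp]
      C.real_cond_exp_intA[OF f] by (intro charact)
  ultimately show ?thesis by eventually_elim simp
qed

text \<open>A measure preserving map under which the factors correspond intertwines the conditional
  expectations: \<open>\<integral>x\<in>A. f (p x) = \<integral>y\<in>B. f y\<close> whenever \<open>p -` B\<close> agrees with \<open>A\<close> up to a null set.\<close>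

lemma real_cond_exp_pullback:
  fixes f :: "'b \<Rightarrow> real"
  assumes C1: "finite_measure_subalgebra M1 C1" and C2: "finite_measure_subalgebra M2 C2"
    and p[measurable]: "p \<in> measurable M1 M2" and distr: "distr M1 M2 p = M2"
    and factors: "eq_mod_null M1 ((\<lambda>B. p -` B \<inter> space M1) ` sets C2) (sets C1)"
    and f: "integrable M2 f"
  shows "AE x in M1. real_cond_exp M1 C1 (\<lambda>x. f (p x)) x = real_cond_exp M2 C2 f (p x)"
proof (rule real_cond_exp_eqI_mod_null[OF C1])
  interpret C1: finite_measure_subalgebra M1 C1 by fact
  interpret C2: finite_measure_subalgebra M2 C2 by fact
  have int_pull: "integrable M1 (\<lambda>x. h (p x))" "(\<integral>x. h (p x) \<partial>M1) = (\<integral>y. h y \<partial>M2)"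
    if "integrable M2 h" for h :: "'b \<Rightarrow> real"
    using that distr integrable_distr[OF p, of h] integral_distr[OF p, of h] by auto
  show "integrable M1 (\<lambda>x. f (p x))" using f by (rule int_pull)
  show "integrable M1 (\<lambda>x. real_cond_exp M2 C2 f (p x))"
    using C2.real_cond_exp_int(1)[OF f] by (rule int_pull)
  show "\<exists>B\<in>sets C1. sym_diff ((\<lambda>x. real_cond_exp M2 C2 f (p x)) -` S \<inter> space M1) B \<in> null_sets M1"
    if "S \<in> sets borel" for S
  proof -
    have "real_cond_exp M2 C2 f -` S \<inter> space C2 \<in> sets C2"
      using that by (rule measurable_sets[OF borel_measurable_cond_exp])
    moreover have "p -` (real_cond_exp M2 C2 f -` S \<inter> space C2) \<inter> space M1
        = (\<lambda>x. real_cond_exp M2 C2 f (p x)) -` S \<inter> space M1"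
      using C2.subalg measurable_space[OF p] by (auto simp: subalgebra_def)
    ultimately have "(\<lambda>x. real_cond_exp M2 C2 f (p x)) -` S \<inter> space M1
        \<in> (\<lambda>B. p -` B \<inter> space M1) ` sets C2" by (intro image_eqI) auto
    then show ?thesis using factors unfolding eq_mod_null_def by blast
  qed
  fix A assume A: "A \<in> sets C1"
  then obtain B where B: "B \<in> sets C2" "sym_diff (p -` B \<inter> space M1) A \<in> null_sets M1"
    using factors unfolding eq_mod_null_def by auto
  have sets: "A \<in> sets M1" "B \<in> sets M2"
    using A B(1) C1.subalg C2.subalg by (auto simp: subalgebra_def)
  have pull_int: "(\<integral>x\<in>A. h (p x) \<partial>M1) = (\<integral>y\<in>B. h y \<partial>M2)" if h: "integrable M2 h" for h :: "'b \<Rightarrow> real"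
  proof -
    have [measurable]: "h \<in> borel_measurable M2" "A \<in> sets M1" "B \<in> sets M2" using h sets by auto
    have "(\<integral>x\<in>A. h (p x) \<partial>M1) = (\<integral>x. indicator B (p x) * h (p x) \<partial>M1)"
      unfolding set_lebesgue_integral_def
    proof (rule integral_cong_AE)
      show "AE x in M1. indicator A x *\<^sub>R h (p x) = indicator B (p x) * h (p x)"
        using AE_mem_eq_of_null_sym_diff[OF B(2)] AE_space
        by eventually_elim (auto simp: indicator_def)
    qed measurable
    also have "\<dots> = (\<integral>y. indicator B y * h y \<partial>M2)"
      using integrable_mult_indicator[OF sets(2) h] by (intro int_pull) simp
    finally show ?thesis by (simp add: set_lebesgue_integral_def)
  qed
  show "(\<integral>x\<in>A. f (p x) \<partial>M1) = (\<integral>x\<in>A. real_cond_exp M2 C2 f (p x) \<partial>M1)"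
    unfolding pull_int[OF f] pull_int[OF C2.real_cond_exp_int(1)[OF f]]
    by (rule C2.real_cond_exp_intA[OF f B(1)])
qed

section \<open>Hamming balls and relative complexity\<close>

lemma cell_eqI:
  assumes "partition_on S P" "A \<in> P" "z \<in> A"
  shows "cell P z = A"
  unfolding cell_def
  using assms partition_onD2[OF assms(1)] by (intro the_equality) (auto simp: disjoint_def)

lemma cell_mem:
  assumes "partition_on S P" "z \<in> S"
  shows "cell P z \<in> P" "z \<in> cell P z"
proof -
  obtain A where "A \<in> P" "z \<in> A" using assms partition_onD1 by blast
  with cell_eqI[OF assms(1) this] show "cell P z \<in> P" "z \<in> cell P z" by auto
qed

lemma cell_measurable:
  assumes "countable_partition M P"
  shows "cell P \<in> measurable M (count_space UNIV)"
proof -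
  have P: "countable P" "P \<subseteq> sets M" "partition_on (space M) P"
    using assms by (auto simp: countable_partition_def)
  show ?thesis
  proof (rule measurableI)
    fix X
    have "cell P -` X \<inter> space M = \<Union>(P \<inter> X)"
      using cell_eqI[OF P(3)] cell_mem[OF P(3)] partition_onD1[OF P(3)] by fastforce
    also have "\<dots> \<in> sets M"
      using P(1,2) by (intro sets.countable_Union) auto
    finally show "cell P -` X \<inter> space M \<in> sets M" .
  qed simp
qed

lemma hamming_dist_commute: "hamming_dist T P n x y = hamming_dist T P n y x"
proof -
  have "{k. k < n \<and> cell P ((T ^^ k) x) \<noteq> cell P ((T ^^ k) y)}
      = {k. k < n \<and> cell P ((T ^^ k) y) \<noteq> cell P ((T ^^ k) x)}" by auto
  then show ?thesis by (simp only: hamming_dist_def)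
qed

lemma hamming_dist_refl [simp]: "hamming_dist T P n x x = 0"
  by (simp add: hamming_dist_def)

lemma hamming_dist_triangle:
  "hamming_dist T P n x z \<le> hamming_dist T P n x y + hamming_dist T P n y z"
proof -
  let ?D = "\<lambda>x y. {k. k < n \<and> cell P ((T ^^ k) x) \<noteq> cell P ((T ^^ k) y)}"
  have "card (?D x z) \<le> card (?D x y \<union> ?D y z)" by (intro card_mono) auto
  also have "\<dots> \<le> card (?D x y) + card (?D y z)" by (rule card_Un_le)
  finally show ?thesis
    unfolding hamming_dist_def add_divide_distrib[symmetric] of_nat_add[symmetric]
    by (intro divide_right_mono) (simp_all only: of_nat_le_iff of_nat_0_le_iff)
qed

lemma hamming_ball_measurable:
  assumes "ppt M T" "countable_partition M P"
  shows "hamming_ball M T n P z \<epsilon> \<in> sets M"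
proof -
  have T: "T \<in> measurable M M" using assms by (simp add: ppt_def)
  have [measurable]: "(\<lambda>y. cell P ((T ^^ k) y)) \<in> measurable M (count_space UNIV)" for k
    by (rule measurable_compose[OF measurable_compose_n[OF T] cell_measurable[OF assms(2)]])
  have "hamming_dist T P n z =
      (\<lambda>y. (\<Sum>k<n. of_bool (cell P ((T ^^ k) z) \<noteq> cell P ((T ^^ k) y))) / real n)"
    by (auto simp: hamming_dist_def fun_eq_iff sum.If_cases of_bool_def Int_def)
  then have "hamming_dist T P n z \<in> borel_measurable M" by simp
  then show ?thesis unfolding hamming_ball_def by measurable
qed

text \<open>A ball depends on its centre only through the word of the \<open>n\<close> cells that the orbit of the centre
  visits, and there are countably many such words.\<close>

lemma countable_hamming_balls:
  assumes "ppt M T" "countable_partition M P"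
  shows "countable ((\<lambda>z. hamming_ball M T n P z \<epsilon>) ` space M)"
proof -
  have P: "countable P" "partition_on (space M) P"
    using assms by (auto simp: countable_partition_def)
  have T: "(T ^^ k) z \<in> space M" if "z \<in> space M" for k z
    using that assms(1) by (induction k) (auto simp: ppt_def bij_betw_def)
  define ball where "ball w = {y \<in> space M.
    real (card {k. k < n \<and> w ! k \<noteq> cell P ((T ^^ k) y)}) / real n \<le> \<epsilon>}" for w
  have "hamming_ball M T n P z \<epsilon> = ball (map (\<lambda>k. cell P ((T ^^ k) z)) [0..<n])" for z
    unfolding hamming_ball_def ball_def hamming_dist_def by (simp cong: conj_cong)
  moreover have "map (\<lambda>k. cell P ((T ^^ k) z)) [0..<n] \<in> lists P" if "z \<in> space M" for z
    using cell_mem(1)[OF P(2) T[OF that]] by auto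
  ultimately have "(\<lambda>z. hamming_ball M T n P z \<epsilon>) ` space M \<subseteq> ball ` lists P" by auto
  then show ?thesis
    by (rule countable_subset) (simp add: P(1) countable_lists)
qed

definition hamming_nbhd ::
  "'a measure \<Rightarrow> ('a \<Rightarrow> 'a) \<Rightarrow> nat \<Rightarrow> 'a set set \<Rightarrow> real \<Rightarrow> 'a set \<Rightarrow> 'a set" where
  "hamming_nbhd M T n P \<epsilon> F = (\<Union>z\<in>F. hamming_ball M T n P z \<epsilon>)"

definition hamming_nbhds ::
  "'a measure \<Rightarrow> ('a \<Rightarrow> 'a) \<Rightarrow> nat \<Rightarrow> 'a set set \<Rightarrow> real \<Rightarrow> 'a set set" where
  "hamming_nbhds M T n P \<epsilon> = hamming_nbhd M T n P \<epsilon> ` {F. finite F \<and> F \<subseteq> space M}"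

lemma countable_hamming_nbhds:
  assumes "ppt M T" "countable_partition M P"
  shows "countable (hamming_nbhds M T n P \<epsilon>)"
proof -
  have "hamming_nbhds M T n P \<epsilon>
      \<subseteq> Union ` {\<B>. finite \<B> \<and> \<B> \<subseteq> (\<lambda>z. hamming_ball M T n P z \<epsilon>) ` space M}"
    unfolding hamming_nbhds_def hamming_nbhd_def
  proof (rule image_subsetI)
    fix F assume "F \<in> {F. finite F \<and> F \<subseteq> space M}"
    then show "(\<Union>z\<in>F. hamming_ball M T n P z \<epsilon>)
        \<in> Union ` {\<B>. finite \<B> \<and> \<B> \<subseteq> (\<lambda>z. hamming_ball M T n P z \<epsilon>) ` space M}"
      by (intro image_eqI[of _ _ "(\<lambda>z. hamming_ball M T n P z \<epsilon>) ` F"]) auto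
  qed
  then show ?thesis
    by (rule countable_subset)
      (intro countable_image countable_Collect_finite_subset countable_hamming_balls assms)
qed

lemma hamming_nbhds_measurable:
  assumes "ppt M T" "countable_partition M P"
  shows "hamming_nbhds M T n P \<epsilon> \<subseteq> sets M"
  unfolding hamming_nbhds_def hamming_nbhd_def
  by (auto intro!: sets.finite_UN hamming_ball_measurable assms)

text \<open>The competitors in the definition of the complexity at the point \<open>x\<close>.\<close>

definition covers ::
  "'a measure \<Rightarrow> ('a \<Rightarrow> 'a) \<Rightarrow> 'a measure \<Rightarrow> 'a set set \<Rightarrow> nat \<Rightarrow> real \<Rightarrow> 'a \<Rightarrow> 'a set \<Rightarrow> bool"
  where
  "covers M T C P n \<epsilon> x F \<longleftrightarrow> finite F \<and> F \<subseteq> space M \<and>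
     real_cond_exp M C (indicator (hamming_nbhd M T n P \<epsilon> F)) x > 1 - \<epsilon>"

lemma rel_complexity_eq: "rel_complexity M T C P n \<epsilon> x = Inf (card ` {F. covers M T C P n \<epsilon> x F})"
  unfolding rel_complexity_def covers_def hamming_nbhd_def ..

lemma rel_complexity_le: "covers M T C P n \<epsilon> x F \<Longrightarrow> rel_complexity M T C P n \<epsilon> x \<le> card F"
  unfolding rel_complexity_eq by (intro wellorder_Inf_le1) auto

lemma rel_complexity_attained:
  assumes "covers M T C P n \<epsilon> x F"
  obtains G where "covers M T C P n \<epsilon> x G" "card G = rel_complexity M T C P n \<epsilon> x"
proof -
  have "card F \<in> card ` {F. covers M T C P n \<epsilon> x F}" using assms by blast
  from wellorder_InfI[OF this] obtain G where
    "covers M T C P n \<epsilon> x G" "rel_complexity M T C P n \<epsilon> x = card G"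
    unfolding rel_complexity_eq by blast
  then show thesis using that by simp
qed

text \<open>The sets of centres are uncountably many, but only the union of their balls enters the
  conditional probability; so the complexity is the least number satisfying a countable disjunction
  of measurable conditions. Measurability matters because the two systems are compared only almost
  everywhere, and a null set may have subsets that are not measurable.\<close>

lemma rel_complexity_measurable:
  assumes "ppt M T" "countable_partition M P" and C: "finite_measure_subalgebra M C"
  shows "rel_complexity M T C P n \<epsilon> \<in> measurable M (count_space UNIV)"
proof -
  interpret finite_measure_subalgebra M C by fact
  let ?U = "hamming_nbhds M T n P \<epsilon>"
  define N where "N U m \<longleftrightarrow> (\<exists>F. finite F \<and> F \<subseteq> space M \<and> hamming_nbhd M T n P \<epsilon> F = U \<and> card F = m)"
    for U m
  have "rel_complexity M T C P n \<epsilon> x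
      = (LEAST m. \<exists>U\<in>?U. N U m \<and> real_cond_exp M C (indicator U) x > 1 - \<epsilon>)" for x
  proof -
    have "m \<in> card ` {F. covers M T C P n \<epsilon> x F} \<longleftrightarrow>
        (\<exists>U\<in>?U. N U m \<and> real_cond_exp M C (indicator U) x > 1 - \<epsilon>)" for m
      unfolding N_def hamming_nbhds_def covers_def image_iff Bex_def mem_Collect_eq by metis
    then show ?thesis unfolding rel_complexity_eq Inf_nat_def by simp
  qed
  moreover have "(\<lambda>x. LEAST m. \<exists>U\<in>?U. N U m \<and> real_cond_exp M C (indicator U) x > 1 - \<epsilon>)
      \<in> measurable M (count_space UNIV)"
    using countable_hamming_nbhds[OF assms(1,2)] by measurable
  ultimately show ?thesis by presburger
qed

text \<open>Finitely many balls already have conditional measure above \<open>1 - \<epsilon>\<close> almost everywhere: there are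
  only countably many balls, and they exhaust the space. If \<open>D\<close> is the set of points where all
  finite stages \<open>U j\<close> fail, integrating the conditional probabilities gives
  \<open>prob (U j) \<le> 1 - \<epsilon> * prob D\<close> while \<open>prob (U j) \<longlonglongrightarrow> 1\<close>, so \<open>D\<close> is null. Hence the infimum
  that defines the complexity is almost everywhere attained, rather than the default value 0.\<close>

lemma AE_covers_exists:
  assumes T: "ppt M T" and P: "countable_partition M P" and C: "finite_measure_subalgebra M C"
    and \<epsilon>: "\<epsilon> > 0"
  shows "AE x in M. \<exists>F. covers M T C P n \<epsilon> x F"
proof -
  interpret finite_measure_subalgebra M C by fact
  interpret prob_space M using T by (simp add: ppt_def)
  let ?ball = "\<lambda>z. hamming_ball M T n P z \<epsilon>"
  define \<B> where "\<B> = ?ball ` space M"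
  have \<B>: "countable \<B>" "\<B> \<noteq> {}"
    unfolding \<B>_def using countable_hamming_balls[OF T P] not_empty by auto
  define U where "U j = (\<Union>i\<le>j. from_nat_into \<B> i)" for j
  have U: "\<exists>F. finite F \<and> F \<subseteq> space M \<and> U j = hamming_nbhd M T n P \<epsilon> F" for j
  proof -
    have "from_nat_into \<B> ` {..j} \<subseteq> ?ball ` space M"
      using from_nat_into[OF \<B>(2)] \<B>_def by auto
    from finite_subset_image[OF _ this] obtain F where
      "F \<subseteq> space M" "finite F" "from_nat_into \<B> ` {..j} = ?ball ` F" by auto
    then show ?thesis unfolding U_def hamming_nbhd_def by metis
  qed
  then have "U j \<in> hamming_nbhds M T n P \<epsilon>" for j unfolding hamming_nbhds_def by blast
  then have sets_U [measurable]: "U j \<in> sets M" for j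
    using hamming_nbhds_measurable[OF T P] by blast
  have "(\<Union>j. U j) = \<Union> (range (from_nat_into \<B>))" unfolding U_def by auto
  also have "\<dots> = \<Union>\<B>" using \<B> by simp
  also have "\<dots> = space M" using \<epsilon> unfolding \<B>_def hamming_ball_def by force
  finally have "(\<lambda>j. prob (U j)) \<longlonglongrightarrow> 1"
    using finite_Lim_measure_incseq[of U] sets_U prob_space
    by (auto simp: incseq_def U_def intro: order_trans)
  let ?E = "\<lambda>j. real_cond_exp M C (indicator (U j))"
  define D where "D = {x \<in> space M. \<forall>j. ?E j x \<le> 1 - \<epsilon>}"
  have [measurable]: "D \<in> sets M" unfolding D_def by measurable
  have "prob (U j) \<le> 1 - \<epsilon> * prob D" for j
  proof -
    have int: "integrable M (indicator (U j) :: 'a \<Rightarrow> real)"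
      by (intro integrable_real_indicator) (auto simp: emeasure_eq_measure)
    have intD: "integrable M (indicator D :: 'a \<Rightarrow> real)"
      by (intro integrable_real_indicator) (auto simp: emeasure_eq_measure)
    have "AE x in M. ?E j x \<le> 1"
      by (rule real_cond_exp_le_c[OF int]) (auto simp: indicator_def)
    then have "AE x in M. ?E j x \<le> 1 - \<epsilon> * indicator D x"
      by eventually_elim (auto simp: indicator_def D_def)
    then have "(\<integral>x. ?E j x \<partial>M) \<le> (\<integral>x. 1 - \<epsilon> * indicator D x \<partial>M)"
      using real_cond_exp_int(1)[OF int] intD by (intro integral_mono_AE) auto
    then show ?thesis
      using real_cond_exp_int(2)[OF int] intD by (simp add: prob_space)
  qed
  then have "1 \<le> 1 - \<epsilon> * prob D"
    using \<open>(\<lambda>j. prob (U j)) \<longlonglongrightarrow> 1\<close> by (intro LIMSEQ_le_const2) auto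
  then have "prob D = 0"
    using \<epsilon> measure_nonneg[of M D] by (simp add: mult_le_0_iff)
  then have "AE x in M. x \<notin> D" using prob_eq_0[of D] by simp
  then show ?thesis
    using AE_space
  proof eventually_elim
    case (elim x)
    then obtain j where "?E j x > 1 - \<epsilon>" unfolding D_def by (auto simp: not_le)
    then show ?case using U[of j] unfolding covers_def by metis
  qed
qed

section \<open>Relative isomorphisms as maps\<close>

text \<open>A relative isomorphism seen in one direction, as an everywhere defined measure preserving map
  which is equivariant on a set \<open>X\<close> of full measure. Invertibility enters only through the last
  condition, that the map identifies the measure algebras. The two directions of an isomorphism give
  two instances, so that one-sided estimates suffice.\<close>

locale relative_isomorphism_map =
  fixes M1 C1 :: "'a measure" and T1 :: "'a \<Rightarrow> 'a" and X :: "'a set"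
    and M2 C2 :: "'b measure" and T2 :: "'b \<Rightarrow> 'b" and p :: "'a \<Rightarrow> 'b"
  assumes ppt1: "ppt M1 T1" and ppt2: "ppt M2 T2"
    and subalgebra1: "subalgebra M1 C1" and subalgebra2: "subalgebra M2 C2"
    and X_sets: "X \<in> sets M1" and X_full: "space M1 - X \<in> null_sets M1" and X_inv: "T1 ` X = X"
    and p_measurable [measurable]: "p \<in> measurable M1 M2" and distr_p: "distr M1 M2 p = M2"
    and p_equivariant: "\<And>x. x \<in> X \<Longrightarrow> p (T1 x) = T2 (p x)"
    and pullback_factor: "eq_mod_null M1 ((\<lambda>B. p -` B \<inter> space M1) ` sets C2) (sets C1)"
    and pullback_sets: "eq_mod_null M1 ((\<lambda>B. p -` B \<inter> space M1) ` sets M2) (sets M1)"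
begin

lemma prob_spaces: "prob_space M1" "prob_space M2"
  using ppt1 ppt2 by (auto simp: ppt_def)

lemma finite_measure_subalgebras: "finite_measure_subalgebra M1 C1" "finite_measure_subalgebra M2 C2"
  using prob_spaces subalgebra1 subalgebra2
  by (auto simp: finite_measure_subalgebra_def finite_measure_subalgebra_axioms_def prob_space_def)

lemma X_subset: "X \<subseteq> space M1"
  using X_sets by (rule sets.sets_into_space)

lemma AE_in_X: "AE x in M1. x \<in> X"
  using AE_not_in[OF X_full] AE_space by eventually_elim auto

lemma p_space: "x \<in> space M1 \<Longrightarrow> p x \<in> space M2"
  using measurable_space[OF p_measurable] .

lemma T1_space: "x \<in> space M1 \<Longrightarrow> (T1 ^^ k) x \<in> space M1"
  using ppt1 by (induction k) (auto simp: ppt_def bij_betw_def)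

lemma T1_mem_X_iff:
  assumes "x \<in> space M1"
  shows "(T1 ^^ k) x \<in> X \<longleftrightarrow> x \<in> X"
proof (induction k)
  case (Suc k)
  have inj: "inj_on T1 (space M1)" using ppt1 by (simp add: ppt_def bij_betw_def)
  have "T1 y \<in> X \<longleftrightarrow> y \<in> X" if "y \<in> space M1" for y
    using inj_on_image_mem_iff[OF inj that X_subset] X_inv by simp
  from this[OF T1_space[OF assms]] Suc show ?case by simp
qed simp

lemma p_funpow: "x \<in> X \<Longrightarrow> p ((T1 ^^ k) x) = (T2 ^^ k) (p x)"
proof (induction k)
  case (Suc k)
  then have "(T1 ^^ k) x \<in> X" using T1_mem_X_iff X_subset by blast
  with Suc show ?case by (simp add: p_equivariant)
qed simp

lemma funpow_image_X: "(T1 ^^ k) ` X = X"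
proof (induction k)
  case (Suc k)
  have "(T1 ^^ Suc k) ` X = T1 ` (T1 ^^ k) ` X" by (simp add: image_comp)
  with Suc show ?case by (simp add: X_inv)
qed simp

text \<open>Inclusions of sets up to null sets become inequalities of conditional probabilities. For countably
  many sets this holds simultaneously outside one null set, so that the centres of the balls
  may be chosen depending on the point.\<close>

lemma AE_cond_prob_compare:
  assumes U: "countable \<U>" "\<U> \<subseteq> sets M1" and V: "countable \<V>" "\<V> \<subseteq> sets M2"
  shows "AE x in M1. \<forall>U\<in>\<U>. \<forall>V\<in>\<V>.
    (U \<inter> X \<subseteq> p -` V \<longrightarrow>
      real_cond_exp M1 C1 (indicator U) x \<le> real_cond_exp M2 C2 (indicator V) (p x)) \<and>
    (p -` V \<inter> X \<subseteq> U \<longrightarrow>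
      real_cond_exp M2 C2 (indicator V) (p x) \<le> real_cond_exp M1 C1 (indicator U) x)"
proof -
  interpret C1: finite_measure_subalgebra M1 C1 by (rule finite_measure_subalgebras)
  interpret C2: finite_measure_subalgebra M2 C2 by (rule finite_measure_subalgebras)
  have "AE x in M1. (U \<inter> X \<subseteq> p -` V \<longrightarrow>
      real_cond_exp M1 C1 (indicator U) x \<le> real_cond_exp M2 C2 (indicator V) (p x)) \<and>
    (p -` V \<inter> X \<subseteq> U \<longrightarrow>
      real_cond_exp M2 C2 (indicator V) (p x) \<le> real_cond_exp M1 C1 (indicator U) x)"
    if "U \<in> \<U>" "V \<in> \<V>" for U V
  proof -
    have sets [measurable]: "U \<in> sets M1" "V \<in> sets M2" using that assms by auto
    let ?pV = "\<lambda>x. indicator V (p x) :: real"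
    have int: "integrable M1 (indicator U :: 'a \<Rightarrow> real)" "integrable M2 (indicator V :: 'b \<Rightarrow> real)"
      by (auto intro!: integrable_real_indicator simp: less_top[symmetric])
    have int': "integrable M1 ?pV"
      using int(2) integrable_distr[OF p_measurable] by (simp add: distr_p)
    have pull: "AE x in M1. real_cond_exp M1 C1 ?pV x = real_cond_exp M2 C2 (indicator V) (p x)"
      by (rule real_cond_exp_pullback[OF finite_measure_subalgebras p_measurable distr_p
            pullback_factor int(2)])
    have "AE x in M1. real_cond_exp M1 C1 (indicator U) x \<le> real_cond_exp M2 C2 (indicator V) (p x)"
      if "U \<inter> X \<subseteq> p -` V"
    proof -
      have "AE x in M1. indicator U x \<le> ?pV x"
        using AE_in_X by eventually_elim (use that in \<open>auto simp: indicator_def\<close>)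
      from C1.real_cond_exp_mono[OF this int(1) int'] pull show ?thesis
        by eventually_elim simp
    qed
    moreover have "AE x in M1. real_cond_exp M2 C2 (indicator V) (p x) \<le> real_cond_exp M1 C1 (indicator U) x"
      if "p -` V \<inter> X \<subseteq> U"
    proof -
      have "AE x in M1. ?pV x \<le> indicator U x"
        using AE_in_X by eventually_elim (use that in \<open>auto simp: indicator_def\<close>)
      from C1.real_cond_exp_mono[OF this int' int(1)] pull show ?thesis
        by eventually_elim simp
    qed
    ultimately show ?thesis by auto
  qed
  then show ?thesis using U(1) V(1) by (simp add: AE_ball_countable)
qed

section \<open>Pulling back partitions\<close>

text \<open>The exceptional set \<open>space M1 - X\<close> becomes a cell of its own. As it is invariant, orbits that start in it
  stay in this cell and are at maximal Hamming distance from those in \<open>X\<close>. The empty set is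
  removed because preimages of null cells may be disjoint from \<open>X\<close>.\<close>

definition pullback :: "'b set set \<Rightarrow> 'a set set" where
  "pullback Q = ((\<lambda>A. p -` A \<inter> X) ` Q \<union> {space M1 - X}) - {{}}"

lemma countable_partition_pullback:
  assumes "countable_partition M2 Q"
  shows "countable_partition M1 (pullback Q)"
proof -
  have Q: "countable Q" "Q \<subseteq> sets M2" "\<Union>Q = space M2" "disjoint Q"
    using assms by (auto simp: countable_partition_def partition_on_def)
  have "p -` A \<inter> X \<in> sets M1" if "A \<in> Q" for A
  proof -
    have "p -` A \<inter> X = (p -` A \<inter> space M1) \<inter> X" using X_subset by auto
    then show ?thesis using that Q(2) X_sets measurable_sets[OF p_measurable] by auto
  qed
  then have "pullback Q \<subseteq> sets M1" unfolding pullback_def using X_sets by auto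
  moreover have "partition_on (space M1) (pullback Q)"
  proof (rule partition_onI)
    have "\<Union>(pullback Q) = (p -` \<Union>Q \<inter> X) \<union> (space M1 - X)"
      unfolding pullback_def by auto
    then show "\<Union>(pullback Q) = space M1" using X_subset p_space Q(3) by auto
    show "disjnt A B" if "A \<in> pullback Q" "B \<in> pullback Q" "A \<noteq> B" for A B
      using that Q(4) unfolding pullback_def disjoint_def disjnt_def by fast
    show "{} \<notin> pullback Q" by (simp add: pullback_def)
  qed
  ultimately show ?thesis
    using Q(1) by (simp add: countable_partition_def pullback_def)
qed

context
  fixes Q assumes Q: "countable_partition M2 Q"
begin

lemma pullback_partition: "partition_on (space M1) (pullback Q)" "partition_on (space M2) Q"
  using Q countable_partition_pullback[OF Q] by (auto simp: countable_partition_def)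

lemma cell_pullback: "x \<in> X \<Longrightarrow> cell (pullback Q) x = p -` cell Q (p x) \<inter> X"
  using cell_mem[OF pullback_partition(2), of "p x"] p_space X_subset
  by (intro cell_eqI[OF pullback_partition(1)]) (auto simp: pullback_def)

lemma cell_pullback_eq_iff:
  assumes "x \<in> X" "y \<in> X"
  shows "cell (pullback Q) x = cell (pullback Q) y \<longleftrightarrow> cell Q (p x) = cell Q (p y)"
proof
  have sp: "p x \<in> space M2" "p y \<in> space M2" using assms X_subset p_space by auto
  assume "cell (pullback Q) x = cell (pullback Q) y"
  then have "p x \<in> cell Q (p y)"
    using assms cell_mem(2)[OF pullback_partition(2) sp(1)] by (auto simp: cell_pullback)
  then show "cell Q (p x) = cell Q (p y)"
    using cell_eqI[OF pullback_partition(2)] cell_mem(1)[OF pullback_partition(2) sp(2)] by blast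
qed (simp add: cell_pullback assms)

lemma hamming_dist_pullback:
  assumes "x \<in> X" "y \<in> X"
  shows "hamming_dist T1 (pullback Q) n x y = hamming_dist T2 Q n (p x) (p y)"
proof -
  have "(T1 ^^ k) z \<in> X" if "z \<in> X" for k z using that X_subset T1_mem_X_iff by blast
  then show ?thesis
    using assms by (simp add: hamming_dist_def cell_pullback_eq_iff p_funpow)
qed

lemma hamming_dist_pullback_off:
  assumes "x \<in> X" "z \<in> space M1 - X" "n > 0"
  shows "hamming_dist T1 (pullback Q) n z x = 1"
proof -
  have "cell (pullback Q) ((T1 ^^ k) z) \<noteq> cell (pullback Q) ((T1 ^^ k) x)" for k
  proof -
    have "(T1 ^^ k) x \<in> X" "(T1 ^^ k) z \<in> space M1" "(T1 ^^ k) z \<notin> X"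
      using assms X_subset T1_mem_X_iff T1_space by blast+
    then show ?thesis
      using cell_pullback cell_mem(2)[OF pullback_partition(1)] by (metis IntD2)
  qed
  then show ?thesis using assms(3) by (simp add: hamming_dist_def)
qed

lemma AE_cond_prob_compare_nbhds:
  "AE x in M1. \<forall>F G. finite F \<and> F \<subseteq> space M1 \<and> finite G \<and> G \<subseteq> space M2 \<longrightarrow>
    (let U = hamming_nbhd M1 T1 n (pullback Q) \<delta> F; V = hamming_nbhd M2 T2 n Q \<epsilon> G in
    (U \<inter> X \<subseteq> p -` V \<longrightarrow>
      real_cond_exp M1 C1 (indicator U) x \<le> real_cond_exp M2 C2 (indicator V) (p x)) \<and>
    (p -` V \<inter> X \<subseteq> U \<longrightarrow>
      real_cond_exp M2 C2 (indicator V) (p x) \<le> real_cond_exp M1 C1 (indicator U) x))"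
  using AE_cond_prob_compare[
      OF countable_hamming_nbhds[OF ppt1 countable_partition_pullback[OF Q]]
        hamming_nbhds_measurable[OF ppt1 countable_partition_pullback[OF Q]]
        countable_hamming_nbhds[OF ppt2 Q] hamming_nbhds_measurable[OF ppt2 Q], of n \<delta> n \<epsilon>]
  by eventually_elim (simp add: hamming_nbhds_def Let_def)

text \<open>Replacing the centres in \<open>X\<close> by their images and dropping the others gives a cover for \<open>Q\<close>. The
  dropped centres are harmless: their distance from \<open>X\<close> is 1, which exceeds \<open>\<epsilon>\<close>.\<close>

lemma rel_complexity_le_pullback:
  assumes "n > 0" "0 < \<epsilon>" "\<epsilon> < 1"
  shows "AE x in M1. rel_complexity M2 T2 C2 Q n \<epsilon> (p x) \<le> rel_complexity M1 T1 C1 (pullback Q) n \<epsilon> x"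
  using AE_cond_prob_compare_nbhds[of n \<epsilon> \<epsilon>]
    AE_covers_exists[OF ppt1 countable_partition_pullback[OF Q] finite_measure_subalgebras(1) assms(2), of n]
proof eventually_elim
  case (elim x)
  let ?U = "hamming_nbhd M1 T1 n (pullback Q) \<epsilon>" and ?V = "hamming_nbhd M2 T2 n Q \<epsilon>"
  obtain F where F: "covers M1 T1 C1 (pullback Q) n \<epsilon> x F"
    "card F = rel_complexity M1 T1 C1 (pullback Q) n \<epsilon> x"
    using rel_complexity_attained elim(2) by metis
  then have fin: "finite F" "F \<subseteq> space M1" by (auto simp: covers_def)
  define G where "G = p ` (F \<inter> X)"
  have G: "finite G" "G \<subseteq> space M2" using fin p_space by (auto simp: G_def)
  have "?U F \<inter> X \<subseteq> p -` ?V G"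
  proof
    fix y assume "y \<in> ?U F \<inter> X"
    then obtain z where z: "y \<in> X" "z \<in> F" "hamming_dist T1 (pullback Q) n z y \<le> \<epsilon>"
      by (auto simp: hamming_nbhd_def hamming_ball_def)
    then have "z \<in> X" using hamming_dist_pullback_off[of y z n] fin assms by fastforce
    then show "y \<in> p -` ?V G"
      using z p_space X_subset
      by (auto simp: hamming_nbhd_def hamming_ball_def hamming_dist_pullback G_def)
  qed
  then have "real_cond_exp M1 C1 (indicator (?U F)) x \<le> real_cond_exp M2 C2 (indicator (?V G)) (p x)"
    using elim(1) fin G unfolding Let_def by blast
  then have "covers M2 T2 C2 Q n \<epsilon> (p x) G"
    using F(1) G by (simp add: covers_def)
  then have "rel_complexity M2 T2 C2 Q n \<epsilon> (p x) \<le> card G" by (rule rel_complexity_le)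
  also have "\<dots> \<le> card (F \<inter> X)" unfolding G_def using fin by (intro card_image_le) auto
  also have "\<dots> \<le> card F" using fin by (intro card_mono) auto
  finally show ?case
    using F(2) by simp
qed

text \<open>A centre in \<open>space M2\<close> may visit a word of cells that is not visited from \<open>p ` X\<close>, and its ball may still
  have positive measure. Any ball which meets \<open>p ` X\<close> is contained in the ball of twice the radius
  around one of its points in \<open>p ` X\<close>. This is why the complexities agree only up to a factor 2 in
  \<open>\<epsilon>\<close>.\<close>

lemma rel_complexity_pullback_le:
  assumes "0 < \<epsilon>"
  shows "AE x in M1.
    rel_complexity M1 T1 C1 (pullback Q) n (2 * \<epsilon>) x \<le> rel_complexity M2 T2 C2 Q n \<epsilon> (p x)"
proof -
  have "AE x in distr M1 M2 p. \<exists>F. covers M2 T2 C2 Q n \<epsilon> x F"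
    unfolding distr_p by (rule AE_covers_exists[OF ppt2 Q finite_measure_subalgebras(2) assms])
  then have "AE x in M1. \<exists>F. covers M2 T2 C2 Q n \<epsilon> (p x) F"
    by (rule AE_distrD[OF p_measurable])
  with AE_cond_prob_compare_nbhds[of n "2 * \<epsilon>" \<epsilon>] show ?thesis
  proof eventually_elim
    case (elim x)
    let ?U = "hamming_nbhd M1 T1 n (pullback Q) (2 * \<epsilon>)" and ?V = "hamming_nbhd M2 T2 n Q \<epsilon>"
    obtain G where G: "covers M2 T2 C2 Q n \<epsilon> (p x) G"
      "card G = rel_complexity M2 T2 C2 Q n \<epsilon> (p x)"
      using rel_complexity_attained elim(2) by metis
    then have fin: "finite G" "G \<subseteq> space M2" by (auto simp: covers_def)
    \<comment> \<open>a point of \<open>X\<close> that \<open>p\<close> maps into the ball around \<open>z\<close>, if there is one; otherwise an arbitrary value,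
      which need not lie in \<open>X\<close> and is discarded below\<close>
    define c where "c z = (SOME y. y \<in> X \<and> hamming_dist T2 Q n z (p y) \<le> \<epsilon>)" for z
    have c: "c z \<in> X" "hamming_dist T2 Q n z (p (c z)) \<le> \<epsilon>"
      if "y \<in> X" "hamming_dist T2 Q n z (p y) \<le> \<epsilon>" for y z
      using someI[of "\<lambda>y. y \<in> X \<and> hamming_dist T2 Q n z (p y) \<le> \<epsilon>"] that
      unfolding c_def by blast+
    define F where "F = c ` G \<inter> X"
    have F: "finite F" "F \<subseteq> space M1" using fin X_subset by (auto simp: F_def)
    have "p -` ?V G \<inter> X \<subseteq> ?U F"
    proof
      fix y assume "y \<in> p -` ?V G \<inter> X"
      then obtain z where z: "y \<in> X" "z \<in> G" "hamming_dist T2 Q n z (p y) \<le> \<epsilon>"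
        by (auto simp: hamming_nbhd_def hamming_ball_def)
      have "hamming_dist T1 (pullback Q) n (c z) y = hamming_dist T2 Q n (p (c z)) (p y)"
        using c z by (intro hamming_dist_pullback) auto
      also have "\<dots> \<le> hamming_dist T2 Q n z (p (c z)) + hamming_dist T2 Q n z (p y)"
        using hamming_dist_triangle hamming_dist_commute by metis
      also have "\<dots> \<le> 2 * \<epsilon>" using c(2)[OF z(1,3)] z(3) by linarith
      finally show "y \<in> ?U F"
        using c(1)[OF z(1,3)] z(1,2) X_subset
        by (auto simp: hamming_nbhd_def hamming_ball_def F_def)
    qed
    then have "real_cond_exp M2 C2 (indicator (?V G)) (p x) \<le> real_cond_exp M1 C1 (indicator (?U F)) x"
      using elim(1) fin F unfolding Let_def by blast
    then have "covers M1 T1 C1 (pullback Q) n (2 * \<epsilon>) x F"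
      using G(1) F assms by (simp add: covers_def)
    then have "rel_complexity M1 T1 C1 (pullback Q) n (2 * \<epsilon>) x \<le> card F"
      by (rule rel_complexity_le)
    also have "\<dots> \<le> card (c ` G)" unfolding F_def using fin by (intro card_mono) auto
    also have "\<dots> \<le> card G" using fin by (intro card_image_le)
    finally show ?case
      using G(2) by simp
  qed
qed

end

end

context relative_isomorphism_map begin

lemma null_sets_pullback: "N \<in> null_sets M2 \<Longrightarrow> p -` N \<inter> space M1 \<in> null_sets M1"
  using null_sets_distr_iff[OF p_measurable, of N] by (simp add: distr_p)

text \<open>Preimages under \<open>p\<close>, cut down to \<open>X\<close>, carry the cells \<open>T2^n A\<close> to the cells \<open>T1^n (p -` A \<inter> X)\<close>, so
  the sigma-algebra generated by \<open>Q\<close> is pulled back into the one generated by \<open>pullback Q\<close>. The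
  former is everything up to null sets, and every measurable set is a preimage up to null sets.\<close>

lemma generator_pullback:
  assumes "generator M2 T2 Q"
  shows "generator M1 T1 (pullback Q)"
proof -
  have Q: "countable_partition M2 Q" using assms by (simp add: generator_def)
  note pull_Q = countable_partition_pullback[OF Q]
  define orbit1 where "orbit1 = (\<Union>n. (\<lambda>A. (T1 ^^ n) ` A) ` pullback Q)
    \<union> (\<Union>n. (\<lambda>A. (T1 ^^ n) -` A \<inter> space M1) ` pullback Q)"
  define orbit2 where "orbit2 = (\<Union>n. (\<lambda>A. (T2 ^^ n) ` A) ` Q)
    \<union> (\<Union>n. (\<lambda>A. (T2 ^^ n) -` A \<inter> space M2) ` Q)"
  have T1: "T1 \<in> measurable M1 M1" using ppt1 by (simp add: ppt_def)
  have image_sets: "(T1 ^^ n) ` A \<in> sets M1" if "A \<in> sets M1" for A n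
  proof (induction n)
    case (Suc n)
    \<comment> \<open>forward images are measurable because they are preimages under the measurable inverse\<close>
    let ?B = "(T1 ^^ n) ` A"
    have B: "?B \<subseteq> space M1" using Suc by (rule sets.sets_into_space)
    have inj: "inj_on T1 (space M1)" and surj: "T1 ` space M1 = space M1"
      using ppt1 by (auto simp: ppt_def bij_betw_def)
    have "T1 ` ?B = the_inv_into (space M1) T1 -` ?B \<inter> space M1"
    proof (intro set_eqI iffI)
      fix y assume "y \<in> T1 ` ?B"
      then show "y \<in> the_inv_into (space M1) T1 -` ?B \<inter> space M1"
        using B inj surj by (auto simp: the_inv_into_f_f subset_iff)
    next
      fix y assume y: "y \<in> the_inv_into (space M1) T1 -` ?B \<inter> space M1"
      then have "T1 (the_inv_into (space M1) T1 y) = y"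
        using f_the_inv_into_f[OF inj] surj by simp
      with y show "y \<in> T1 ` ?B" by (metis IntD1 imageI vimageE)
    qed
    also have "\<dots> \<in> sets M1"
      using ppt1 Suc unfolding ppt_def by (intro measurable_sets[of _ M1 M1]) auto
    finally show ?case by (simp add: image_comp)
  qed (use that in simp)
  have orbit1_sets: "orbit1 \<subseteq> sets M1"
    using pull_Q image_sets measurable_sets[OF measurable_compose_n[OF T1]]
    unfolding orbit1_def countable_partition_def by blast
  have "orbit1 \<subseteq> Pow (space M1)" using orbit1_sets sets.space_closed by blast
  then interpret S1: sigma_algebra "space M1" "sigma_sets (space M1) orbit1"
    by (rule sigma_algebra_sigma_sets)
  have cells: "(T1 ^^ n) ` A \<in> sigma_sets (space M1) orbit1"
    "(T1 ^^ n) -` A \<inter> space M1 \<in> sigma_sets (space M1) orbit1"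
    if "A = {} \<or> A \<in> pullback Q" for A n
  proof -
    have "(T1 ^^ n) ` A \<in> orbit1 \<and> (T1 ^^ n) -` A \<inter> space M1 \<in> orbit1" if "A \<in> pullback Q"
      using that unfolding orbit1_def by blast
    then show "(T1 ^^ n) ` A \<in> sigma_sets (space M1) orbit1"
      "(T1 ^^ n) -` A \<inter> space M1 \<in> sigma_sets (space M1) orbit1"
      using that sigma_sets.Empty[of "space M1" orbit1] by (auto intro: sigma_sets.Basic)
  qed
  \<comment> \<open>complements relative to \<open>X\<close> are available because \<open>space M1 - X\<close> is a cell, unless it is empty\<close>
  have X_in: "X \<in> sigma_sets (space M1) orbit1"
  proof -
    have "(T1 ^^ 0) ` (space M1 - X) \<in> sigma_sets (space M1) orbit1"
      by (rule cells) (auto simp: pullback_def)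
    then have "space M1 - (space M1 - X) \<in> sigma_sets (space M1) orbit1"
      unfolding funpow_0 image_ident by (rule sigma_sets.Compl)
    moreover have "space M1 - (space M1 - X) = X" using X_subset by auto
    ultimately show ?thesis by simp
  qed
  have pull: "p -` B \<inter> X \<in> sigma_sets (space M1) orbit1"
    if "B \<in> sigma_sets (space M2) orbit2" for B
    using that
  proof induction
    case (Basic B)
    then obtain A n where A: "A \<in> Q" and B: "B = (T2 ^^ n) ` A \<or> B = (T2 ^^ n) -` A \<inter> space M2"
      unfolding orbit2_def by auto
    have sp: "A \<subseteq> space M2"
      using A Q by (auto simp: countable_partition_def partition_on_def)
    have cell: "p -` A \<inter> X = {} \<or> p -` A \<inter> X \<in> pullback Q"
      using A by (auto simp: pullback_def)
    have X_iff: "(T1 ^^ n) x \<in> X \<longleftrightarrow> x \<in> X" if "x \<in> space M1" for x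
      using that by (rule T1_mem_X_iff)
    from B show ?case
    proof
      assume B: "B = (T2 ^^ n) ` A"
      have "bij_betw T2 (space M2) (space M2)" using ppt2 by (simp add: ppt_def)
      then have inj: "inj_on (T2 ^^ n) (space M2)"
        using bij_betw_funpow bij_betw_def by blast
      have "p -` B \<inter> X = (T1 ^^ n) ` (p -` A \<inter> X)"
      proof (intro set_eqI iffI)
        fix x assume x: "x \<in> p -` B \<inter> X"
        then obtain a x' where a: "a \<in> A" "p x = (T2 ^^ n) a" and x': "x' \<in> X" "x = (T1 ^^ n) x'"
          using B funpow_image_X[of n] by blast
        then have "(T2 ^^ n) (p x') = (T2 ^^ n) a" by (simp add: p_funpow)
        then have "p x' = a"
          using inj_onD[OF inj] x'(1) X_subset p_space a(1) sp by blast
        then show "x \<in> (T1 ^^ n) ` (p -` A \<inter> X)" using a x' by blast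
      next
        fix x assume "x \<in> (T1 ^^ n) ` (p -` A \<inter> X)"
        then show "x \<in> p -` B \<inter> X"
          using B X_iff X_subset by (auto simp: p_funpow subset_iff)
      qed
      then show ?thesis using cells(1)[OF cell] by simp
    next
      assume B: "B = (T2 ^^ n) -` A \<inter> space M2"
      have "p -` B \<inter> X = (T1 ^^ n) -` (p -` A \<inter> X) \<inter> space M1"
        using B X_iff X_subset p_space by (auto simp: p_funpow subset_iff)
      then show ?thesis using cells(2)[OF cell] by simp
    qed
  next
    case (Compl B)
    have "p -` (space M2 - B) \<inter> X = X - (p -` B \<inter> X)" using X_subset p_space by auto
    with Compl X_in show ?case by (simp add: S1.Diff)
  next
    case (Union B)
    have eq: "p -` (\<Union>i. B i) \<inter> X = (\<Union>i. p -` B i \<inter> X)" by auto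
    show ?case unfolding eq using Union by (intro sigma_sets.Union)
  qed (simp add: sigma_sets.Empty)
  have sub: "sigma_sets (space M1) orbit1 \<subseteq> sets M1"
    using orbit1_sets by (rule sets.sigma_sets_subset)
  have "eq_mod_null M1 (sigma_sets (space M1) orbit1) (sets M1)"
    unfolding eq_mod_null_def
  proof (intro conjI ballI)
    fix A assume "A \<in> sigma_sets (space M1) orbit1"
    then show "\<exists>B\<in>sets M1. sym_diff A B \<in> null_sets M1" using sub by (auto intro!: bexI[of _ A])
  next
    fix A assume A: "A \<in> sets M1"
    then obtain B where B: "B \<in> sets M2" "sym_diff (p -` B \<inter> space M1) A \<in> null_sets M1"
      using pullback_sets unfolding eq_mod_null_def by auto
    obtain B' where B': "B' \<in> sigma_sets (space M2) orbit2" "sym_diff B' B \<in> null_sets M2"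
      using assms B(1) unfolding generator_def eq_mod_null_def orbit2_def by blast
    have "sym_diff (p -` B' \<inter> X) A \<in> null_sets M1"
    proof (rule null_sets_subset)
      show "(space M1 - X) \<union> (p -` sym_diff B' B \<inter> space M1) \<union> sym_diff (p -` B \<inter> space M1) A
          \<in> null_sets M1"
        by (intro null_sets.Un X_full null_sets_pullback B B')
      show "sym_diff (p -` B' \<inter> X) A \<in> sets M1"
        using pull[OF B'(1)] sub A by blast
      show "sym_diff (p -` B' \<inter> X) A
          \<subseteq> (space M1 - X) \<union> (p -` sym_diff B' B \<inter> space M1) \<union> sym_diff (p -` B \<inter> space M1) A"
        using X_subset sets.sets_into_space[OF A] by auto
    qed
    then show "\<exists>A'\<in>sigma_sets (space M1) orbit1. sym_diff A' A \<in> null_sets M1"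
      using pull[OF B'(1)] by blast
  qed
  then show ?thesis
    using pull_Q unfolding generator_def orbit1_def by blast
qed

end

section \<open>Double limits along measure preserving maps\<close>

text \<open>At 0, which occurs as the value of an infimum over the empty set, the logarithm has the value 0.\<close>

lemma ln_of_nat_mono: "a \<le> b \<Longrightarrow> ln (real a) \<le> ln (real b)"
  by (cases "a = 0"; cases "b = 0") (auto simp: ln_ge_zero Suc_leI)

lemma dlim_in_distribution_distr:
  assumes p: "p \<in> measurable M1 M2" and distr: "distr M1 M2 p = M2"
    and Z: "\<And>k \<epsilon>. Z k \<epsilon> \<in> borel_measurable M2"
  shows "dlim_in_distribution M1 (\<lambda>k \<epsilon> x. Z k \<epsilon> (p x)) N Y \<longleftrightarrow> dlim_in_distribution M2 Z N Y"
proof -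
  have "(\<integral>x. g (Z k \<epsilon> (p x)) \<partial>M1) = (\<integral>y. g (Z k \<epsilon> y) \<partial>M2)"
    if "continuous_on UNIV g" for g :: "ennreal \<Rightarrow> real" and k \<epsilon>
    using integral_distr[OF p, of "\<lambda>y. g (Z k \<epsilon> y)"]
      measurable_compose[OF Z borel_measurable_continuous_onI[OF that]] distr by simp
  then show ?thesis unfolding dlim_in_distribution_def by simp
qed

text \<open>A common form of the normalised logarithms in the definitions of asymptotic complexity and of the
  entropy dimensions. All that is used about the scaling \<open>\<phi> k\<close> is its monotonicity.\<close>

definition scaled_complexity ::
  "(nat \<Rightarrow> nat \<Rightarrow> ennreal) \<Rightarrow> (nat \<Rightarrow> nat) \<Rightarrow> 'a measure \<Rightarrow> ('a \<Rightarrow> 'a) \<Rightarrow> 'a measure \<Rightarrow> 'a set set \<Rightarrow>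
    nat \<Rightarrow> real \<Rightarrow> 'a \<Rightarrow> ennreal" where
  "scaled_complexity \<phi> n M T C P k \<epsilon> x = \<phi> k (rel_complexity M T C P (n k) \<epsilon> x)"

lemma limsup_tendsto_0_at_right_mono:
  fixes a b :: "nat \<Rightarrow> real \<Rightarrow> real"
  assumes "((\<lambda>\<epsilon>. limsup (\<lambda>k. ereal (b k \<epsilon>))) \<longlongrightarrow> 0) (at_right 0)"
    and nonneg: "\<And>k \<epsilon>. 0 \<le> a k \<epsilon>" "\<And>k \<epsilon>. 0 \<le> b k \<epsilon>"
    and le: "\<And>k \<epsilon>. 0 < \<epsilon> \<Longrightarrow> \<epsilon> < 1 \<Longrightarrow> a k \<epsilon> \<le> b k \<epsilon>"
  shows "((\<lambda>\<epsilon>. limsup (\<lambda>k. ereal (a k \<epsilon>))) \<longlongrightarrow> 0) (at_right 0)"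
  unfolding limsup_tendsto_0_at_right_iff[of a, OF nonneg(1)]
proof (intro allI impI)
  fix e :: real assume "e > 0"
  then have "\<forall>\<^sub>F \<epsilon> in at_right 0. \<forall>\<^sub>F k in sequentially. b k \<epsilon> < e"
    using assms(1) unfolding limsup_tendsto_0_at_right_iff[of b, OF nonneg(2)] by blast
  moreover have "\<forall>\<^sub>F \<epsilon> in at_right 0. (0::real) < \<epsilon> \<and> \<epsilon> < 1"
    unfolding eventually_at_right_field by (intro exI[of _ 1]) auto
  ultimately show "\<forall>\<^sub>F \<epsilon> in at_right 0. \<forall>\<^sub>F k in sequentially. a k \<epsilon> < e"
  proof eventually_elim
    case (elim \<epsilon>)
    from elim(1) show ?case
      by (rule eventually_mono) (use le elim(2) in \<open>auto intro: le_less_trans\<close>)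
  qed
qed

context relative_isomorphism_map begin

lemma measure_pullback:
  assumes A: "{y \<in> space M2. A y} \<in> sets M2"
  shows "measure M2 {y \<in> space M2. A y} = measure M1 {x \<in> space M1. A (p x)}"
proof -
  have eq: "p -` {y \<in> space M2. A y} \<inter> space M1 = {x \<in> space M1. A (p x)}"
    using p_space by auto
  show ?thesis using measure_distr[OF p_measurable A] unfolding distr_p eq .
qed

context
  fixes Q and n :: "nat \<Rightarrow> nat" and \<phi> :: "nat \<Rightarrow> nat \<Rightarrow> ennreal"
  assumes Q: "countable_partition M2 Q" and n: "\<And>k. n k > 0" and \<phi>: "\<And>k. mono (\<phi> k)"
begin

abbreviation "Z1 \<equiv> scaled_complexity \<phi> n M1 T1 C1 (pullback Q)"
abbreviation "Z2 \<equiv> scaled_complexity \<phi> n M2 T2 C2 Q"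

lemma Z_measurable: "Z1 k \<epsilon> \<in> borel_measurable M1" "Z2 k \<epsilon> \<in> borel_measurable M2"
  unfolding scaled_complexity_def[abs_def]
  by (intro measurable_compose[OF rel_complexity_measurable] ppt1 ppt2
      countable_partition_pullback Q finite_measure_subalgebras; simp)+

lemma AE_Z_le:
  assumes "0 < \<epsilon>" "\<epsilon> < 1"
  shows "AE x in M1. Z2 k \<epsilon> (p x) \<le> Z1 k \<epsilon> x"
  using rel_complexity_le_pullback[OF Q n[of k] assms]
  by eventually_elim (simp add: scaled_complexity_def monoD[OF \<phi>])

lemma AE_Z_ge:
  assumes "0 < \<epsilon>"
  shows "AE x in M1. Z1 k (2 * \<epsilon>) x \<le> Z2 k \<epsilon> (p x)"
  using rel_complexity_pullback_le[OF Q assms, of "n k"]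
  by eventually_elim (simp add: scaled_complexity_def monoD[OF \<phi>])

lemma dlim_in_distribution_pullback:
  assumes "dlim_in_distribution M1 Z1 N Y"
  shows "dlim_in_distribution M2 Z2 N Y"
proof -
  have "dlim_in_distribution M1 (\<lambda>k \<epsilon> x. Z2 k \<epsilon> (p x)) N Y"
  proof (rule dlim_in_distribution_sandwich[OF prob_spaces(1) _ _ _ assms])
    fix k \<epsilon>
    show "(\<lambda>x. Z2 k \<epsilon> (p x)) \<in> borel_measurable M1"
      by (rule measurable_compose[OF p_measurable Z_measurable(2)])
    assume "0 < \<epsilon>" "\<epsilon> < 1/2"
    then have "AE x in M1. Z1 k (2 * \<epsilon>) x \<le> Z2 k \<epsilon> (p x)" "AE x in M1. Z2 k \<epsilon> (p x) \<le> Z1 k \<epsilon> x"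
      by (auto intro: AE_Z_le AE_Z_ge)
    then show "AE x in M1. Z1 k (2 * \<epsilon>) x \<le> Z2 k \<epsilon> (p x) \<and> Z2 k \<epsilon> (p x) \<le> Z1 k \<epsilon> x"
      by eventually_elim simp
  qed (rule Z_measurable)
  then show ?thesis
    by (simp add: dlim_in_distribution_distr[OF p_measurable distr_p Z_measurable(2)])
qed

lemma dlim_zero_in_measure_pullback:
  assumes "dlim_zero_in_measure M1 Z1"
  shows "dlim_zero_in_measure M2 Z2"
  unfolding dlim_zero_in_measure_def
proof (intro allI impI)
  fix \<eta> :: real assume \<eta>: "\<eta> > 0"
  interpret prob_space M1 by (rule prob_spaces)
  note [measurable] = Z_measurable
  show "((\<lambda>\<epsilon>. limsup (\<lambda>k. ereal (measure M2 {y \<in> space M2. Z2 k \<epsilon> y > ennreal \<eta>}))) \<longlongrightarrow> 0)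
    (at_right 0)"
  proof (rule limsup_tendsto_0_at_right_mono)
    show "((\<lambda>\<epsilon>. limsup (\<lambda>k. ereal (measure M1 {x \<in> space M1. Z1 k \<epsilon> x > ennreal \<eta>}))) \<longlongrightarrow> 0)
      (at_right 0)"
      using assms \<eta> unfolding dlim_zero_in_measure_def by blast
    fix k \<epsilon> assume "0 < \<epsilon>" "\<epsilon> < (1::real)"
    then have "AE x in M1. Z2 k \<epsilon> (p x) \<le> Z1 k \<epsilon> x" by (rule AE_Z_le)
    then have "measure M1 {x \<in> space M1. Z2 k \<epsilon> (p x) > ennreal \<eta>}
        \<le> measure M1 {x \<in> space M1. Z1 k \<epsilon> x > ennreal \<eta>}"
      by (intro finite_measure_mono_AE) (auto elim!: eventually_mono)
    then show "measure M2 {y \<in> space M2. Z2 k \<epsilon> y > ennreal \<eta>}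
        \<le> measure M1 {x \<in> space M1. Z1 k \<epsilon> x > ennreal \<eta>}"
      by (subst measure_pullback) simp_all
  qed simp_all
qed

lemma dlim_infinity_in_measure_pullback:
  assumes "dlim_infinity_in_measure M2 Z2"
  shows "dlim_infinity_in_measure M1 Z1"
  unfolding dlim_infinity_in_measure_def
proof (intro allI impI)
  fix b :: real assume b: "b > 0"
  interpret prob_space M1 by (rule prob_spaces)
  note [measurable] = Z_measurable
  show "((\<lambda>\<epsilon>. limsup (\<lambda>k. ereal (measure M1 {x \<in> space M1. Z1 k \<epsilon> x < ennreal b}))) \<longlongrightarrow> 0)
    (at_right 0)"
  proof (rule limsup_tendsto_0_at_right_mono)
    show "((\<lambda>\<epsilon>. limsup (\<lambda>k. ereal (measure M2 {y \<in> space M2. Z2 k \<epsilon> y < ennreal b}))) \<longlongrightarrow> 0)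
      (at_right 0)"
      using assms b unfolding dlim_infinity_in_measure_def by blast
    fix k \<epsilon> assume "0 < \<epsilon>" "\<epsilon> < (1::real)"
    then have "AE x in M1. Z2 k \<epsilon> (p x) \<le> Z1 k \<epsilon> x" by (rule AE_Z_le)
    then have "measure M1 {x \<in> space M1. Z1 k \<epsilon> x < ennreal b}
        \<le> measure M1 {x \<in> space M1. Z2 k \<epsilon> (p x) < ennreal b}"
      by (intro finite_measure_mono_AE) (auto elim!: eventually_mono)
    then show "measure M1 {x \<in> space M1. Z1 k \<epsilon> x < ennreal b}
        \<le> measure M2 {y \<in> space M2. Z2 k \<epsilon> y < ennreal b}"
      by (subst measure_pullback) simp_all
  qed simp_all
qed

end

lemma mono_log_ratio:
  assumes "c \<ge> 0"
  shows "mono (\<lambda>m. ennreal (ln (real m) / c))"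
  using ln_of_nat_mono assms by (intro monoI ennreal_leI divide_right_mono)

lemma complexity_approx_transfer:
  assumes n: "\<And>k. n k > 0" and d: "\<And>k. d k > 0"
    and "complexity_approx M1 T1 C1 n d N Y"
  shows "complexity_approx M2 T2 C2 n d N Y"
  unfolding complexity_approx_def
proof (intro allI impI)
  fix Q assume gen: "generator M2 T2 Q"
  then have Q: "countable_partition M2 Q" by (simp add: generator_def)
  have mono: "mono (\<lambda>m. ennreal (1 / d k * ln (real m)))" for k
    using mono_log_ratio[of "d k"] d[of k] by simp
  let ?\<phi> = "\<lambda>k m. ennreal (1 / d k * ln (real m))"
  have "dlim_in_distribution M1 (scaled_complexity ?\<phi> n M1 T1 C1 (pullback Q)) N Y"
    using assms(3) generator_pullback[OF gen]
    unfolding complexity_approx_def scaled_complexity_def[abs_def] by simp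
  then have "dlim_in_distribution M2 (scaled_complexity ?\<phi> n M2 T2 C2 Q) N Y"
    by (rule dlim_in_distribution_pullback[OF Q n mono])
  then show "dlim_in_distribution M2
      (\<lambda>k \<epsilon> x. ennreal (1 / d k * ln (real (rel_complexity M2 T2 C2 Q (n k) \<epsilon> x)))) N Y"
    unfolding scaled_complexity_def[abs_def] .
qed

lemma log_complexity_ratio_eq:
  "log_complexity_ratio M T C P n s =
    scaled_complexity (\<lambda>k m. ennreal (ln (real m) / real (n k) powr s)) n M T C P"
  by (simp add: log_complexity_ratio_def scaled_complexity_def fun_eq_iff)

text \<open>An exponent admissible for \<open>M1\<close> is admissible for \<open>M2\<close>, because every partition of \<open>M2\<close> has a
  pullback.\<close>

lemma upper_E_dim_le:
  assumes n: "\<And>k. n k > 0"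
  shows "upper_E_dim n M2 T2 C2 \<le> upper_E_dim n M1 T1 C1"
  unfolding upper_E_dim_def
proof (intro Inf_superset_mono image_mono Collect_mono impI conjI allI; elim conjE)
  fix s :: real and Q
  assume "\<forall>P. countable_partition M1 P \<longrightarrow> dlim_zero_in_measure M1 (log_complexity_ratio M1 T1 C1 P n s)"
    and Q: "countable_partition M2 Q"
  then have "dlim_zero_in_measure M1 (log_complexity_ratio M1 T1 C1 (pullback Q) n s)"
    using countable_partition_pullback by blast
  moreover have mono: "mono (\<lambda>m. ennreal (ln (real m) / real (n k) powr s))" for k
    by (intro mono_log_ratio) simp
  ultimately show "dlim_zero_in_measure M2 (log_complexity_ratio M2 T2 C2 Q n s)"
    unfolding log_complexity_ratio_eq by (intro dlim_zero_in_measure_pullback[OF Q n])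
qed

text \<open>The pullback of a partition witnessing divergence on \<open>M2\<close> witnesses divergence on \<open>M1\<close>.\<close>

lemma lower_E_dim_le:
  assumes n: "\<And>k. n k > 0"
  shows "lower_E_dim n M2 T2 C2 \<le> lower_E_dim n M1 T1 C1"
  unfolding lower_E_dim_def
proof (intro Sup_subset_mono image_mono Collect_mono impI; elim conjE exE)
  fix s :: real and Q
  assume "s \<ge> 0" and Q: "countable_partition M2 Q"
    and inf: "dlim_infinity_in_measure M2 (log_complexity_ratio M2 T2 C2 Q n s)"
  have mono: "mono (\<lambda>m. ennreal (ln (real m) / real (n k) powr s))" for k
    by (intro mono_log_ratio) simp
  have "dlim_infinity_in_measure M1 (log_complexity_ratio M1 T1 C1 (pullback Q) n s)"
    using inf unfolding log_complexity_ratio_eq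
    by (rule dlim_infinity_in_measure_pullback[OF Q n mono])
  then show "s \<ge> 0 \<and> (\<exists>P. countable_partition M1 P \<and>
      dlim_infinity_in_measure M1 (log_complexity_ratio M1 T1 C1 P n s))"
    using \<open>s \<ge> 0\<close> countable_partition_pullback[OF Q] by blast
qed

end

section \<open>Symmetry of relative isomorphism\<close>

context
  fixes M1 :: "'a measure" and T1 X1 and M2 :: "'b measure" and T2 X2 \<pi>
  assumes iso: "ppt_isomorphism M1 T1 X1 M2 T2 X2 \<pi>"
begin

lemma isomorphism_domains:
  "X1 \<in> sets M1" "space M1 - X1 \<in> null_sets M1" "T1 ` X1 = X1" "X1 \<subseteq> space M1"
  "X2 \<in> sets M2" "space M2 - X2 \<in> null_sets M2" "T2 ` X2 = X2" "X2 \<subseteq> space M2"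
  "space (restrict_space M1 X1) = X1" "space (restrict_space M2 X2) = X2"
  using iso sets.sets_into_space[of X1 M1] sets.sets_into_space[of X2 M2]
  by (auto simp: ppt_isomorphism_def space_restrict_space)

lemma isomorphism_bij: "inj_on \<pi> X1" "\<pi> ` X1 = X2"
  using iso by (auto simp: ppt_isomorphism_def bij_betw_def)

lemma isomorphism_measurable:
  "\<pi> \<in> measurable (restrict_space M1 X1) (restrict_space M2 X2)"
  "the_inv_into X1 \<pi> \<in> measurable (restrict_space M2 X2) (restrict_space M1 X1)"
  "distr (restrict_space M1 X1) (restrict_space M2 X2) \<pi> = restrict_space M2 X2"
  using iso by (auto simp: ppt_isomorphism_def)

lemma isomorphism_preimage:
  assumes "B \<in> sets M2"
  shows "\<pi> -` B \<inter> X1 \<in> sets M1" "emeasure M1 (\<pi> -` B \<inter> X1) = emeasure M2 B"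
proof -
  have B: "B \<inter> X2 \<in> sets (restrict_space M2 X2)"
    using assms by (auto simp: sets_restrict_space)
  have eq: "\<pi> -` (B \<inter> X2) \<inter> X1 = \<pi> -` B \<inter> X1" using isomorphism_bij(2) by auto
  then have eq': "\<pi> -` B \<inter> \<pi> -` X2 \<inter> X1 = \<pi> -` B \<inter> X1" by simp
  have X: "X1 \<inter> space M1 \<in> sets M1" "X2 \<inter> space M2 \<in> sets M2" using isomorphism_domains by auto
  have "\<pi> -` (B \<inter> X2) \<inter> X1 \<in> sets (restrict_space M1 X1)"
    using measurable_sets[OF isomorphism_measurable(1) B] by (simp add: isomorphism_domains)
  then show "\<pi> -` B \<inter> X1 \<in> sets M1" by (simp add: sets_restrict_space_iff[OF X(1)] eq')
  have "emeasure M1 (\<pi> -` B \<inter> X1) = emeasure (restrict_space M1 X1) (\<pi> -` (B \<inter> X2) \<inter> X1)"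
    by (subst emeasure_restrict_space[OF X(1)]) (auto simp: eq')
  also have "\<dots> = emeasure (restrict_space M2 X2) (B \<inter> X2)"
    using emeasure_distr[OF isomorphism_measurable(1) B]
    by (simp add: isomorphism_measurable(3) isomorphism_domains)
  also have "\<dots> = emeasure M2 (B \<inter> X2)"
    by (rule emeasure_restrict_space[OF X(2)]) auto
  also have "B \<inter> X2 = B - (space M2 - X2)"
    using assms by (auto dest: sets.sets_into_space)
  also have "emeasure M2 (B - (space M2 - X2)) = emeasure M2 B"
    by (rule emeasure_Diff_null_set[OF isomorphism_domains(6) assms])
  finally show "emeasure M1 (\<pi> -` B \<inter> X1) = emeasure M2 B" .
qed

lemma isomorphism_image_sets:
  assumes "A \<in> sets M1"
  shows "\<pi> ` (A \<inter> X1) \<in> sets M2"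
proof -
  have X: "X2 \<inter> space M2 \<in> sets M2" using isomorphism_domains by auto
  have "\<pi> ` (A \<inter> X1) = the_inv_into X1 \<pi> -` (A \<inter> X1) \<inter> X2"
  proof (intro set_eqI iffI)
    fix y assume "y \<in> \<pi> ` (A \<inter> X1)"
    then show "y \<in> the_inv_into X1 \<pi> -` (A \<inter> X1) \<inter> X2"
      using isomorphism_bij by (auto simp: the_inv_into_f_f)
  next
    fix y assume y: "y \<in> the_inv_into X1 \<pi> -` (A \<inter> X1) \<inter> X2"
    then have "\<pi> (the_inv_into X1 \<pi> y) = y"
      using isomorphism_bij by (intro f_the_inv_into_f) auto
    with y show "y \<in> \<pi> ` (A \<inter> X1)" by (metis IntD1 imageI vimageE)
  qed
  also have "\<dots> \<in> sets (restrict_space M2 X2)"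
    using measurable_sets[OF isomorphism_measurable(2), of "A \<inter> X1"] assms
    by (auto simp: isomorphism_domains sets_restrict_space)
  finally show ?thesis by (simp add: sets_restrict_space_iff[OF X])
qed

text \<open>Transport of null sets along the isomorphism, in the form needed for factors: \<open>D\<close> stands for the
  preimage of \<open>B\<close>, whatever it does outside \<open>X1\<close>.\<close>

lemma isomorphism_null_sym_diff:
  assumes A: "A \<in> sets M1" and B: "B \<in> sets M2" and D: "D \<in> sets M1"
    and null: "sym_diff (\<pi> ` (A \<inter> X1)) B \<in> null_sets M2" and eq: "D \<inter> X1 = \<pi> -` B \<inter> X1"
  shows "sym_diff D A \<in> null_sets M1"
proof (rule null_sets_subset)
  let ?N = "\<pi> -` sym_diff (\<pi> ` (A \<inter> X1)) B \<inter> X1"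
  have "?N \<in> null_sets M1"
    using isomorphism_preimage[OF null_setsD2[OF null]] null_setsD1[OF null] by (intro null_setsI) simp_all
  then show "(space M1 - X1) \<union> ?N \<in> null_sets M1"
    by (intro null_sets.Un isomorphism_domains)
  show "sym_diff D A \<in> sets M1" using A D by auto
  show "sym_diff D A \<subseteq> (space M1 - X1) \<union> ?N"
  proof
    fix x assume x: "x \<in> sym_diff D A"
    have "\<pi> x \<in> \<pi> ` (A \<inter> X1) \<longleftrightarrow> x \<in> A" if "x \<in> X1"
      using that isomorphism_bij(1) by (auto dest: inj_onD)
    then show "x \<in> (space M1 - X1) \<union> ?N"
      using x eq sets.sets_into_space[OF A] sets.sets_into_space[OF D] by blast
  qed
qed

end

lemma relatively_isomorphic_sym:
  assumes "relatively_isomorphic M1 T1 C1 M2 T2 C2"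
    and C1: "subalgebra M1 C1" and C2: "subalgebra M2 C2"
  shows "relatively_isomorphic M2 T2 C2 M1 T1 C1"
proof -
  obtain X1 X2 \<pi> where iso: "ppt_isomorphism M1 T1 X1 M2 T2 X2 \<pi>"
    and factor: "eq_mod_null M2 ((\<lambda>A. \<pi> ` (A \<inter> X1)) ` sets C1) (sets C2)"
    using assms(1) unfolding relatively_isomorphic_def by auto
  let ?\<rho> = "the_inv_into X1 \<pi>"
  note dom = isomorphism_domains[OF iso] and \<pi> = isomorphism_measurable[OF iso]
    and bij = isomorphism_bij[OF iso]
  have bij_inv: "bij_betw ?\<rho> X2 X1"
    using bij by (intro bij_betw_the_inv_into) (simp add: bij_betw_def)
  have equiv: "\<pi> (T1 x) = T2 (\<pi> x)" if "x \<in> X1" for x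
    using iso that by (simp add: ppt_isomorphism_def)
  have \<rho>\<pi>: "?\<rho> (\<pi> x) = x" if "x \<in> X1" for x using that bij by (simp add: the_inv_into_f_f)
  have \<pi>\<rho>: "\<pi> (?\<rho> y) = y" "?\<rho> y \<in> X1" if "y \<in> X2" for y
    using that bij f_the_inv_into_f[OF bij(1), of y] the_inv_into_into[OF bij(1), of y X1] by auto
  have "ppt_isomorphism M2 T2 X2 M1 T1 X1 ?\<rho>"
    unfolding ppt_isomorphism_def
  proof (intro conjI dom bij_inv \<pi> ballI)
    show "the_inv_into X2 ?\<rho> \<in> measurable (restrict_space M1 X1) (restrict_space M2 X2)"
    proof (subst measurable_cong[where g = \<pi>])
      fix x assume "x \<in> space (restrict_space M1 X1)"
      then have x: "x \<in> X1" by (simp add: dom)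
      then have "\<pi> x \<in> X2" using bij by blast
      then show "the_inv_into X2 ?\<rho> x = \<pi> x"
        using the_inv_into_f_f[of ?\<rho> X2 "\<pi> x"] bij_inv \<rho>\<pi>[OF x] by (simp add: bij_betw_def)
    qed (rule \<pi>)
    have "distr (restrict_space M2 X2) (restrict_space M1 X1) ?\<rho>
        = distr (distr (restrict_space M1 X1) (restrict_space M2 X2) \<pi>) (restrict_space M1 X1) ?\<rho>"
      by (simp only: \<pi>)
    also have "\<dots> = distr (restrict_space M1 X1) (restrict_space M1 X1) (?\<rho> \<circ> \<pi>)"
      by (rule distr_distr[OF \<pi>(2,1)])
    also have "\<dots> = distr (restrict_space M1 X1) (restrict_space M1 X1) (\<lambda>x. x)"
      by (rule distr_cong) (auto simp: dom \<rho>\<pi>)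
    also have "\<dots> = restrict_space M1 X1" by (rule distr_id)
    finally show "distr (restrict_space M2 X2) (restrict_space M1 X1) ?\<rho> = restrict_space M1 X1" .
    fix y assume y: "y \<in> X2"
    have "T1 (?\<rho> y) \<in> X1" using \<pi>\<rho>(2)[OF y] dom(3) by blast
    from \<rho>\<pi>[OF this] show "?\<rho> (T2 y) = T1 (?\<rho> y)" using \<pi>\<rho>[OF y] by (simp add: equiv)
  qed
  moreover have "eq_mod_null M1 ((\<lambda>B. ?\<rho> ` (B \<inter> X2)) ` sets C2) (sets C1)"
  proof -
    have key: "sym_diff (?\<rho> ` (B \<inter> X2)) A \<in> null_sets M1"
      if A: "A \<in> sets C1" and B: "B \<in> sets C2" and null: "sym_diff (\<pi> ` (A \<inter> X1)) B \<in> null_sets M2"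
      for A B
    proof (rule isomorphism_null_sym_diff[OF iso])
      show sets: "A \<in> sets M1" "B \<in> sets M2" using A B C1 C2 by (auto simp: subalgebra_def)
      have eq: "?\<rho> ` (B \<inter> X2) = \<pi> -` B \<inter> X1"
      proof (intro set_eqI iffI)
        fix x assume "x \<in> ?\<rho> ` (B \<inter> X2)"
        then show "x \<in> \<pi> -` B \<inter> X1" using \<pi>\<rho> by auto
      next
        fix x assume x: "x \<in> \<pi> -` B \<inter> X1"
        then have "\<pi> x \<in> B \<inter> X2" using bij(2) by blast
        with x \<rho>\<pi> show "x \<in> ?\<rho> ` (B \<inter> X2)" by (metis IntD2 imageI)
      qed
      then show "?\<rho> ` (B \<inter> X2) \<inter> X1 = \<pi> -` B \<inter> X1" by blast
      show "?\<rho> ` (B \<inter> X2) \<in> sets M1" unfolding eq by (rule isomorphism_preimage[OF iso sets(2)])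
    qed (rule null)
    show ?thesis
      unfolding eq_mod_null_def
    proof (intro conjI ballI)
      fix B' assume "B' \<in> (\<lambda>B. ?\<rho> ` (B \<inter> X2)) ` sets C2"
      then obtain B where B: "B \<in> sets C2" "B' = ?\<rho> ` (B \<inter> X2)" by auto
      then obtain A where "A \<in> sets C1" "sym_diff (\<pi> ` (A \<inter> X1)) B \<in> null_sets M2"
        using factor unfolding eq_mod_null_def by blast
      with B key show "\<exists>A\<in>sets C1. sym_diff B' A \<in> null_sets M1" by blast
    next
      fix A assume A: "A \<in> sets C1"
      then obtain B where "B \<in> sets C2" "sym_diff (\<pi> ` (A \<inter> X1)) B \<in> null_sets M2"
        using factor unfolding eq_mod_null_def by blast
      with A key show "\<exists>B'\<in>(\<lambda>B. ?\<rho> ` (B \<inter> X2)) ` sets C2. sym_diff B' A \<in> null_sets M1"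
        by blast
    qed
  qed
  ultimately show ?thesis unfolding relatively_isomorphic_def by blast
qed

text \<open>The isomorphism is extended to a total map by a constant on the exceptional null set.\<close>

lemma relatively_isomorphic_imp_map:
  assumes T1: "ppt M1 T1" and T2: "ppt M2 T2"
    and C1: "subalgebra M1 C1" and C2: "subalgebra M2 C2"
    and "relatively_isomorphic M1 T1 C1 M2 T2 C2"
  obtains X p where "relative_isomorphism_map M1 C1 T1 X M2 C2 T2 p"
proof -
  interpret M2: prob_space M2 using T2 by (simp add: ppt_def)
  obtain X1 X2 \<pi> where iso: "ppt_isomorphism M1 T1 X1 M2 T2 X2 \<pi>"
    and factor: "eq_mod_null M2 ((\<lambda>A. \<pi> ` (A \<inter> X1)) ` sets C1) (sets C2)"
    using assms(5) unfolding relatively_isomorphic_def by auto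
  note dom = isomorphism_domains[OF iso] and bij = isomorphism_bij[OF iso]
  obtain y0 where y0: "y0 \<in> space M2" using M2.not_empty by blast
  define p where "p x = (if x \<in> X1 then \<pi> x else y0)" for x
  have pre: "p -` B \<inter> space M1 = (\<pi> -` B \<inter> X1) \<union> (if y0 \<in> B then space M1 - X1 else {})" for B
    using dom(4) by (auto simp: p_def split: if_splits)
  have null: "(if y0 \<in> B then space M1 - X1 else {}) \<in> null_sets M1" for B
    using dom(2) by auto
  have pre_sets: "p -` B \<inter> space M1 \<in> sets M1" if "B \<in> sets M2" for B
    unfolding pre using isomorphism_preimage(1)[OF iso that] null_setsD2[OF null] by (intro sets.Un)
  have p: "p \<in> measurable M1 M2"
    using pre_sets y0 bij(2) dom(8) by (intro measurableI) (auto simp: p_def)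
  have sub: "sets C1 \<subseteq> sets M1" "sets C2 \<subseteq> sets M2" using C1 C2 by (auto simp: subalgebra_def)
  have key: "sym_diff (p -` B \<inter> space M1) A \<in> null_sets M1"
    if "A \<in> sets M1" "B \<in> sets M2" "sym_diff (\<pi> ` (A \<inter> X1)) B \<in> null_sets M2" for A B
    using that pre_sets[OF that(2)] dom(4)
    by (intro isomorphism_null_sym_diff[OF iso, of A B]) (auto simp: p_def)
  show thesis
  proof (rule that, unfold_locales)
    show "distr M1 M2 p = M2"
    proof (rule measure_eqI)
      fix B assume "B \<in> sets (distr M1 M2 p)"
      then have B: "B \<in> sets M2" by simp
      have "emeasure M1 (p -` B \<inter> space M1) = emeasure M1 (\<pi> -` B \<inter> X1)"
        unfolding pre by (rule emeasure_Un_null_set[OF isomorphism_preimage(1)[OF iso B] null])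
      then show "emeasure (distr M1 M2 p) B = emeasure M2 B"
        using emeasure_distr[OF p B] isomorphism_preimage(2)[OF iso B] by simp
    qed simp
    show "p (T1 x) = T2 (p x)" if "x \<in> X1" for x
      using that iso dom(3) by (auto simp: p_def ppt_isomorphism_def)
    show "eq_mod_null M1 ((\<lambda>B. p -` B \<inter> space M1) ` sets C2) (sets C1)"
      unfolding eq_mod_null_def
    proof (intro conjI ballI)
      fix B' assume "B' \<in> (\<lambda>B. p -` B \<inter> space M1) ` sets C2"
      then obtain B where B: "B \<in> sets C2" "B' = p -` B \<inter> space M1" by auto
      then obtain A where "A \<in> sets C1" "sym_diff (\<pi> ` (A \<inter> X1)) B \<in> null_sets M2"
        using factor unfolding eq_mod_null_def by blast
      with B key sub show "\<exists>A\<in>sets C1. sym_diff B' A \<in> null_sets M1" by blast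
    next
      fix A assume A: "A \<in> sets C1"
      then obtain B where "B \<in> sets C2" "sym_diff (\<pi> ` (A \<inter> X1)) B \<in> null_sets M2"
        using factor unfolding eq_mod_null_def by blast
      with A key sub show "\<exists>B'\<in>(\<lambda>B. p -` B \<inter> space M1) ` sets C2. sym_diff B' A \<in> null_sets M1"
        by blast
    qed
    show "eq_mod_null M1 ((\<lambda>B. p -` B \<inter> space M1) ` sets M2) (sets M1)"
      unfolding eq_mod_null_def
    proof (intro conjI ballI)
      fix B' assume "B' \<in> (\<lambda>B. p -` B \<inter> space M1) ` sets M2"
      then show "\<exists>A\<in>sets M1. sym_diff B' A \<in> null_sets M1"
        using pre_sets by (intro bexI[of _ B']) auto
    next
      fix A assume A: "A \<in> sets M1"
      have "sym_diff (p -` (\<pi> ` (A \<inter> X1)) \<inter> space M1) A \<in> null_sets M1"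
        by (rule key[OF A isomorphism_image_sets[OF iso A]]) simp
      then show "\<exists>B'\<in>(\<lambda>B. p -` B \<inter> space M1) ` sets M2. sym_diff B' A \<in> null_sets M1"
        using isomorphism_image_sets[OF iso A] by blast
    qed
  qed (use T1 T2 C1 C2 dom p in auto)
qed

section \<open>Invariance of relative complexity\<close>

theorem corollary4:
  fixes M1 C1 :: "'a measure" and T1 :: "'a \<Rightarrow> 'a"
    and M2 C2 :: "'b measure" and T2 :: "'b \<Rightarrow> 'b"
    and n :: "nat \<Rightarrow> nat" and d :: "nat \<Rightarrow> real"
    and N :: "'c measure" and Y :: "'c \<Rightarrow> ennreal"
  assumes "ppt M1 T1" and "is_factor M1 T1 C1"
    and "ppt M2 T2" and "is_factor M2 T2 C2"
    and "relatively_isomorphic M1 T1 C1 M2 T2 C2"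
    and "\<And>k. n k > 0" and "filterlim n at_top sequentially"
    and "\<And>k. d k > 0"
    and "prob_space N" and "Y \<in> borel_measurable N"
  shows "(complexity_approx M1 T1 C1 n d N Y \<longleftrightarrow> complexity_approx M2 T2 C2 n d N Y) \<and>
    upper_E_dim n M1 T1 C1 = upper_E_dim n M2 T2 C2 \<and>
    lower_E_dim n M1 T1 C1 = lower_E_dim n M2 T2 C2"
proof -
  have sub: "subalgebra M1 C1" "subalgebra M2 C2" using assms(2,4) by (auto simp: is_factor_def)
  obtain X p where "relative_isomorphism_map M1 C1 T1 X M2 C2 T2 p"
    using relatively_isomorphic_imp_map[OF assms(1,3) sub assms(5)] .
  then interpret A: relative_isomorphism_map M1 C1 T1 X M2 C2 T2 p .
  obtain X' q where "relative_isomorphism_map M2 C2 T2 X' M1 C1 T1 q"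
    using relatively_isomorphic_imp_map[OF assms(3,1) sub(2,1)
        relatively_isomorphic_sym[OF assms(5) sub]] .
  then interpret B: relative_isomorphism_map M2 C2 T2 X' M1 C1 T1 q .
  show ?thesis
    using A.complexity_approx_transfer[of n d N Y] B.complexity_approx_transfer[of n d N Y]
      A.upper_E_dim_le[of n] B.upper_E_dim_le[of n] A.lower_E_dim_le[of n] B.lower_E_dim_le[of n]
      assms(6,8)
    by (auto intro: order_antisym)
qed

end
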